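(* Let $X^n=\mathbb{E}^n$ or $\mathbb{H}^n$, let $M$ and $M'$ be geometric $n$-manifolds with universal cover $X^n$, each with a given finite decomposition into convex polyhedra, and let $T$ and $T'$ be the tilings of $X^n$ which cover these two decompositions. Let $S$ and $S'$ be the sets of polyhedra decomposing $M$ and $M'$ respectively, and let $\Theta$ be the set of all triples $(j,p,p')$ where $p\in S$, $p'\in S'$, and $j$ is an isometry carrying $p$ onto $p'$. Then the tilings $T$ and $T'$ are isometric if and only if there exists a non-empty subset $I$ of $\Theta$ such that every element of $I$ extends across each of its faces to yield another element of $I$.
   Context: The manifolds $M$, $M'$ are complete quotients of $X^n$ by groups of covering transformations acting by isometries. Each decomposition is obtained by gluing finitely many convex polyhedra in $X^n$ (compact, or, when $X^n=\mathbb{H}^n$, possibly with ideal vertices) isometrically along pairs of codimension $1$ faces; the elements of $S$ and $S'$ are regarded as these polyhedra together with the face gluings. "Face" means codimension $1$ face. The elements of $T$ (resp. $T'$) are the convex polyhedra in $X^n$ which project to the polyhedra in $S$ (resp. $S'$). The tilings $T$ and $T'$ are isometric if some isometry of $X^n$ carries the elements of $T$ onto the elements of $T'$. Extension across a face: let $(j,p,p')\in\Theta$ and let $f$ be a face of $p$. Let $q\in S$ be the neighbour of $p$ at $f$ (the polyhedron glued to $p$ along $f$) and let $q'\in S'$ be the neighbour of $p'$ at the face $j(f)$. Via the gluing maps, the restriction of $j$ to $f$ induces an isometry from the face of $q$ glued to $f$ onto the face of $q'$ glued to $j(f)$. If this isometry of faces extends to an isometry $j_q$ carrying $q$ onto $q'$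 (so $(j_q,q,q')\in\Theta$), one says that $(j,p,p')$ extends across $f$ to $(j_q,q,q')$. The condition on $I$ is that for every $(j,p,p')\in I$ and every face $f$ of $p$, $(j,p,p')$ extends across $f$ to a triple which belongs to $I$ (this triple is not required to be different from $(j,p,p')$). *)

theory Defs
  imports "HOL-Analysis.Analysis" "HOL-Algebra.Bij"
begin

text \<open>
  The geometry \<open>X\<close>, modelled inside a Euclidean space of dimension \<open>n = DIM('a)\<close>. For hyperbolic
  space this is the Klein (projective) model of curvature \<open>-1\<close>: its points form the open unit ball
  and its geodesics are straight segments, so geodesic convexity, convex polyhedra and their facets
  are those of the ambient affine space, and the ideal points form the unit sphere.
\<close>

datatype geometry = Euclidean | Hyperbolic

fun model_space :: "geometry \<Rightarrow> 'a::euclidean_space set" where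
  "model_space Euclidean = UNIV"
| "model_space Hyperbolic = ball 0 1"

definition klein_dist :: "'a::euclidean_space \<Rightarrow> 'a \<Rightarrow> real" where
  "klein_dist x y =
     arcosh ((1 - x \<bullet> y) / (sqrt (1 - (norm x)\<^sup>2) * sqrt (1 - (norm y)\<^sup>2)))"

fun model_dist :: "geometry \<Rightarrow> 'a::euclidean_space \<Rightarrow> 'a \<Rightarrow> real" where
  "model_dist Euclidean = dist"
| "model_dist Hyperbolic = klein_dist"

definition isometry :: "geometry \<Rightarrow> 'a::euclidean_space set \<Rightarrow> 'a set \<Rightarrow> ('a \<Rightarrow> 'a) \<Rightarrow> bool" where
  "isometry G A B j \<longleftrightarrow>
     j ` A = B \<and> (\<forall>x\<in>A. \<forall>y\<in>A. model_dist G (j x) (j y) = model_dist G x y)"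

text \<open>
  Full-dimensional convex polyhedra of \<open>X\<close>. In the Euclidean case \<open>closure (model_space G) = UNIV\<close>
  and these are the compact ones. In the hyperbolic case \<open>P\<close> lies in the closed unit ball; since
  the sphere is strictly convex, the points of \<open>P\<close> on it are vertices of \<open>P\<close>: the ideal
  vertices, which do not belong to \<open>p\<close>. The faces of codimension 1 are given by \<open>f facet_of p\<close>.
\<close>

definition convex_polyhedron :: "geometry \<Rightarrow> 'a::euclidean_space set \<Rightarrow> bool" where
  "convex_polyhedron G p \<longleftrightarrow>
     (\<exists>P. polytope P \<and> P \<subseteq> closure (model_space G) \<and> p = P \<inter> model_space G) \<and> interior p \<noteq> {}"

text \<open>
  The manifold is \<open>M = X / \<Gamma>\<close>. The metric of \<open>X\<close> induces the subspace topology of \<open>'a\<close>, so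
  evenly covered neighbourhoods may be taken open in \<open>'a\<close>. For a group of isometries of \<open>X\<close>
  this covering condition implies proper discontinuity, hence that \<open>M\<close> is Hausdorff.
\<close>

definition covering_group :: "geometry \<Rightarrow> ('a::euclidean_space \<Rightarrow> 'a) set \<Rightarrow> bool" where
  "covering_group G \<Gamma> \<longleftrightarrow>
     subgroup \<Gamma> (BijGroup (model_space G)) \<and>
     (\<forall>\<gamma>\<in>\<Gamma>. isometry G (model_space G) (model_space G) \<gamma>) \<and>
     (\<forall>x\<in>model_space G. \<exists>U. open U \<and> x \<in> U \<and> U \<subseteq> model_space G \<and>
        (\<forall>\<gamma>\<in>\<Gamma>. \<gamma> \<noteq> \<one>\<^bsub>BijGroup (model_space G)\<^esub> \<longrightarrow> \<gamma> ` U \<inter> U = {}))"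

definition proj :: "('a \<Rightarrow> 'a) set \<Rightarrow> 'a \<Rightarrow> 'a set" where
  "proj \<Gamma> x = (\<lambda>\<gamma>. \<gamma> x) ` \<Gamma>"

definition quotient_manifold :: "geometry \<Rightarrow> ('a::euclidean_space \<Rightarrow> 'a) set \<Rightarrow> 'a set set" where
  "quotient_manifold G \<Gamma> = proj \<Gamma> ` model_space G"

text \<open>
  A decomposition, given by its polyhedra and their face gluings: the polyhedron named \<open>s\<close> is
  \<open>body s\<close>; its face \<open>f\<close> is glued to a face of the polyhedron named \<open>nbr s f\<close> by
  \<open>glue s f\<close>; and \<open>charmap s\<close> is the map from \<open>body s\<close> into \<open>M\<close>. Names are
  used because different polyhedra of a decomposition may be congruent, even equal, as
  subsets of \<open>X\<close>.
\<close>

record ('a, 's) decomposition =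
  cells :: "'s set"
  body :: "'s \<Rightarrow> 'a set"
  nbr :: "'s \<Rightarrow> 'a set \<Rightarrow> 's"
  glue :: "'s \<Rightarrow> 'a set \<Rightarrow> 'a \<Rightarrow> 'a"
  charmap :: "'s \<Rightarrow> 'a \<Rightarrow> 'a set"

text \<open>
  The faces are glued in pairs: \<open>(s, f)\<close> is paired with a different \<open>(t, f')\<close>, where \<open>t\<close> may be
  \<open>s\<close>, and the two gluing maps of a pair are inverse to each other.
\<close>

definition face_pairing ::
  "geometry \<Rightarrow> ('a::euclidean_space, 's) decomposition \<Rightarrow> bool" where
  "face_pairing G D \<longleftrightarrow>
     (\<forall>s\<in>cells D. \<forall>f. f facet_of body D s \<longrightarrow>
        (let t = nbr D s f; \<phi> = glue D s f; f' = \<phi> ` f in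
           t \<in> cells D \<and> f' facet_of body D t \<and> isometry G f f' \<phi> \<and> (t, f') \<noteq> (s, f) \<and>
           nbr D t f' = s \<and> (\<forall>x\<in>f. glue D t f' (\<phi> x) = x)))"

definition glued ::
  "('a::euclidean_space, 's) decomposition \<Rightarrow> 's \<times> 'a \<Rightarrow> 's \<times> 'a \<Rightarrow> bool" where
  "glued D u v \<longleftrightarrow>
     (\<exists>s f x. s \<in> cells D \<and> f facet_of body D s \<and> x \<in> f \<and>
        u = (s, x) \<and> v = (nbr D s f, glue D s f x))"

text \<open>\<open>h\<close> develops the polyhedron \<open>s\<close> onto the convex polyhedron \<open>t\<close> of \<open>X\<close>, which projects to it.\<close>

definition lifts ::
  "geometry \<Rightarrow> ('a::euclidean_space \<Rightarrow> 'a) set \<Rightarrow> ('a, 's) decomposition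
     \<Rightarrow> 's \<Rightarrow> 'a set \<Rightarrow> ('a \<Rightarrow> 'a) \<Rightarrow> bool" where
  "lifts G \<Gamma> D s t h \<longleftrightarrow>
     convex_polyhedron G t \<and> isometry G (body D s) t h \<and>
     (\<forall>x\<in>body D s. proj \<Gamma> (h x) = charmap D s x)"

text \<open>
  The last two conditions say that \<open>M\<close> is the space obtained from the disjoint union of the
  polyhedra by the identifications generated by the face gluings.
\<close>

definition decomposes ::
  "geometry \<Rightarrow> ('a::euclidean_space \<Rightarrow> 'a) set \<Rightarrow> ('a, 's) decomposition \<Rightarrow> bool" where
  "decomposes G \<Gamma> D \<longleftrightarrow>
     finite (cells D) \<and>
     (\<forall>s\<in>cells D. convex_polyhedron G (body D s)) \<and>
     face_pairing G D \<and>
     (\<forall>s\<in>cells D. \<exists>t h. lifts G \<Gamma> D s t h) \<and>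
     (\<Union>s\<in>cells D. charmap D s ` body D s) = quotient_manifold G \<Gamma> \<and>
     (\<forall>s\<in>cells D. \<forall>t\<in>cells D. \<forall>x\<in>body D s. \<forall>y\<in>body D t.
        charmap D s x = charmap D t y \<longleftrightarrow> equivclp (glued D) (s, x) (t, y))"

definition tiling ::
  "geometry \<Rightarrow> ('a::euclidean_space \<Rightarrow> 'a) set \<Rightarrow> ('a, 's) decomposition \<Rightarrow> 'a set set" where
  "tiling G \<Gamma> D = {t. \<exists>s\<in>cells D. \<exists>h. lifts G \<Gamma> D s t h}"

definition isometric_tilings ::
  "geometry \<Rightarrow> 'a::euclidean_space set set \<Rightarrow> 'a set set \<Rightarrow> bool" where
  "isometric_tilings G T T' \<longleftrightarrow>
     (\<exists>g. isometry G (model_space G) (model_space G) g \<and> (\<lambda>t. g ` t) ` T = T')"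

text \<open>
  The isometries are taken extensional, so that each is determined by its values on the
  polyhedron \<open>p\<close>.
\<close>

definition Theta ::
  "geometry \<Rightarrow> ('a::euclidean_space, 's) decomposition \<Rightarrow> ('a, 't) decomposition
     \<Rightarrow> (('a \<Rightarrow> 'a) \<times> 's \<times> 't) set" where
  "Theta G D D' =
     {(j, p, p'). p \<in> cells D \<and> p' \<in> cells D' \<and>
        j \<in> extensional (body D p) \<and> isometry G (body D p) (body D' p') j}"

text \<open>
  With \<open>\<phi> = glue D p f\<close> and \<open>\<phi>' = glue D' p' (j ` f)\<close>, the isometry of faces induced by \<open>j\<close> is
  \<open>\<phi>' \<circ> j \<circ> \<phi>\<inverse>\<close> on \<open>\<phi> ` f\<close>; the last conjunct says that \<open>k\<close> extends it.
\<close>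

definition extends_across ::
  "('a::euclidean_space, 's) decomposition \<Rightarrow> ('a, 't) decomposition
     \<Rightarrow> ('a \<Rightarrow> 'a) \<times> 's \<times> 't \<Rightarrow> 'a set \<Rightarrow> ('a \<Rightarrow> 'a) \<times> 's \<times> 't \<Rightarrow> bool" where
  "extends_across D D' = (\<lambda>(j, p, p') f (k, q, q').
     q = nbr D p f \<and> q' = nbr D' p' (j ` f) \<and>
     (\<forall>x\<in>f. k (glue D p f x) = glue D' p' (j ` f) (j x)))"

end

(*
  An isometry between full-dimensional subsets of X extends to all of X: in the Euclidean case as an
  affine orthogonal map, in the Klein model as the projective map of a linear isometry of the Lorentz
  form. It therefore preserves polyhedra and facets, and two isometries of a polyhedron that agree on
  a facet and map the polyhedron to the same side of it coincide, since otherwise the bisector of the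
  two images of some point would be the hyperplane of the facet. Two tiles (with their developing
  maps) whose interiors meet are equal, because interior points of the polyhedra are not glued to
  anything.

  If g maps T onto T', the triples induced by g form a suitable I: the image of a neighbouring tile
  and the corresponding neighbour in T' lie on the same side of a common facet, so they overlap and
  coincide. Conversely a triple in I determines an isometry g of X, and by rigidity across facets the
  property "g maps this tile to a tile of T', inducing a triple in I" spreads from a tile to its
  neighbours, hence to all of T because T is connected through facets.
*)

theory Submission
  imports Defs
begin

section \<open>Model spaces and their isometries\<close>

text \<open>Both geometries share one extension argument: a map preserving a nondegenerate bilinear
  form on a spanning set is linear there. The form is the inner product in the Euclidean case. In
  the hyperbolic case it is the Lorentz form on \<open>'a \<times> real\<close>, with Klein points
  lifted to the hyperboloid, where minus the form is the cosh of the distance. The obstacle is that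
  motions of the Klein model are not affine in general. Hulls and facets are therefore transported
  through images of segments, taken in the closed ball because of ideal vertices, while interiors
  and dimensions are transported by topological invariance. A decomposition provides only gluings
  and maps into the quotient, so the developments of two neighbours need not match in
  \<open>X\<close>. Two lifts of the same map on a connected set differ by one deck transformation,
  and correcting by it makes them agree along the facet. That a face is never paired with itself is
  what keeps neighbours from overlapping.\<close>

lemma convex_model_space: "convex (model_space G)"
  by (cases G) auto

lemma open_model_space: "open (model_space G)"
  by (cases G) auto

lemma zero_in_model_space: "0 \<in> model_space G"
  by (cases G) auto

lemma interior_model_space: "interior (model_space G :: 'a::euclidean_space set) \<noteq> {}"
  using zero_in_model_space[of G] interior_open[OF open_model_space[of G]] by auto

section \<open>The Klein distance through its hyperbolic cosine\<close>

definition klein_cosh :: "'a::euclidean_space \<Rightarrow> 'a \<Rightarrow> real" where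
  "klein_cosh x y = (1 - x \<bullet> y) / (sqrt (1 - (norm x)\<^sup>2) * sqrt (1 - (norm y)\<^sup>2))"

lemma klein_dist_eq: "klein_dist x y = arcosh (klein_cosh x y)"
  by (simp add: klein_dist_def klein_cosh_def)

lemma klein_factor_pos:
  assumes "x \<in> ball 0 1"
  shows "0 < 1 - (norm x)\<^sup>2" and "0 < sqrt (1 - (norm x)\<^sup>2)"
proof -
  have "(norm x)\<^sup>2 < 1" using assms abs_square_less_1[of "norm x"] by simp
  then show "0 < 1 - (norm x)\<^sup>2" and "0 < sqrt (1 - (norm x)\<^sup>2)" by simp_all
qed

lemma inner_less_one:
  fixes x y :: "'a::euclidean_space"
  assumes "norm x \<le> 1" and "norm y < 1"
  shows "x \<bullet> y < 1"
proof -
  have "x \<bullet> y \<le> norm x * norm y" by (rule norm_cauchy_schwarz)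
  also have "\<dots> \<le> 1 * norm y" using assms by (intro mult_right_mono) auto
  finally show ?thesis using assms by simp
qed

lemma klein_cosh_pos:
  assumes "x \<in> ball 0 1" and "y \<in> ball 0 1"
  shows "0 < klein_cosh x y"
proof -
  have "x \<bullet> y < 1" using assms by (intro inner_less_one) auto
  then show ?thesis unfolding klein_cosh_def
    using klein_factor_pos(2)[OF assms(1)] klein_factor_pos(2)[OF assms(2)]
    by (intro divide_pos_pos mult_pos_pos) auto
qed

text \<open>One estimate serves three ends: cosh is at least 1, distinct points are separated, and
  isometries are continuous. Its right side is the squared sinh of the distance; the proof weakens a
  factor \<open>1 - Y\<close> to 1 and then completes a square.\<close>

lemma klein_cosh_bound:
  fixes x y :: "'a::euclidean_space"
  assumes "x \<in> ball 0 1" and "y \<in> ball 0 1"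
  shows "(norm (x - y))\<^sup>2 \<le> (klein_cosh x y)\<^sup>2 - 1"
proof -
  define X Y p where "X = x \<bullet> x" and "Y = y \<bullet> y" and "p = x \<bullet> y"
  have X: "0 < 1 - X" "(norm x)\<^sup>2 = X" and Y: "0 < 1 - Y" "(norm y)\<^sup>2 = Y" "0 \<le> Y"
    using klein_factor_pos(1)[OF assms(1)] klein_factor_pos(1)[OF assms(2)]
    by (simp_all add: X_def Y_def power2_norm_eq_inner)
  have c: "(klein_cosh x y)\<^sup>2 = (1 - p)\<^sup>2 / ((1 - X) * (1 - Y))"
    using X Y by (simp add: klein_cosh_def p_def power_divide power_mult_distrib)
  have n: "(norm (x - y))\<^sup>2 = X + Y - 2 * p"
    by (simp add: power2_norm_eq_inner X_def Y_def p_def algebra_simps inner_commute)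
  then have n0: "0 \<le> X + Y - 2 * p" by (metis zero_le_power2)
  have "(X + Y - 2 * p) * ((1 - X) * (1 - Y)) \<le> (X + Y - 2 * p) * (1 - X)"
    using X Y n0 by (intro mult_left_mono) (auto simp: mult_le_cancel_left1)
  \<comment> \<open>The two sides differ by exactly \<open>(p - X)\<^sup>2\<close>.\<close>
  also have "\<dots> \<le> (1 - p)\<^sup>2 - (1 - X) * (1 - Y)"
    using zero_le_power2[of "p - X"] by (simp add: power2_eq_square algebra_simps)
  finally have "X + Y - 2 * p \<le> ((1 - p)\<^sup>2 - (1 - X) * (1 - Y)) / ((1 - X) * (1 - Y))"
    using X Y by (simp add: pos_le_divide_eq)
  also have "\<dots> = (klein_cosh x y)\<^sup>2 - 1"
    using X Y by (simp add: c diff_divide_distrib)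
  finally show ?thesis by (simp add: n)
qed

lemma klein_cosh_ge_1:
  assumes "x \<in> ball 0 1" and "y \<in> ball 0 1"
  shows "1 \<le> klein_cosh x y"
proof -
  have "1 \<le> (klein_cosh x y)\<^sup>2"
    using klein_cosh_bound[OF assms] zero_le_power2[of "norm (x - y)"] by linarith
  then show ?thesis using klein_cosh_pos[OF assms]
    by (smt (verit) power_less_one_iff one_power2 power2_le_imp_le)
qed

lemma klein_cosh_self:
  assumes "x \<in> ball 0 1"
  shows "klein_cosh x x = 1"
proof -
  have "x \<bullet> x = (norm x)\<^sup>2" by (simp add: power2_norm_eq_inner)
  then show ?thesis
    using klein_factor_pos(1)[OF assms] by (simp add: klein_cosh_def)
qed

lemma klein_cosh_gt_1:
  assumes "x \<in> ball 0 1" and "y \<in> ball 0 1" and "x \<noteq> y"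
  shows "1 < klein_cosh x y"
proof -
  have "0 < (norm (x - y))\<^sup>2" using assms(3) by simp
  then have "klein_cosh x y \<noteq> 1"
    using klein_cosh_bound[OF assms(1,2)] by auto
  then show ?thesis using klein_cosh_ge_1[OF assms(1,2)] by simp
qed

lemma klein_dist_eq_iff:
  assumes "x \<in> ball 0 1" "y \<in> ball 0 1" "x' \<in> ball 0 1" "y' \<in> ball 0 1"
  shows "klein_dist x y = klein_dist x' y' \<longleftrightarrow> klein_cosh x y = klein_cosh x' y'"
proof
  assume "klein_dist x y = klein_dist x' y'"
  then have "cosh (arcosh (klein_cosh x y)) = cosh (arcosh (klein_cosh x' y'))"
    by (simp only: klein_dist_eq)
  then show "klein_cosh x y = klein_cosh x' y'"
    using klein_cosh_ge_1[OF assms(1,2)] klein_cosh_ge_1[OF assms(3,4)] by simp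
qed (simp only: klein_dist_eq)

text \<open>Once the factor depending on \<open>z\<close> alone is cancelled, equality of the two
  cosh distances is an affine equation in \<open>z\<close>, so bisectors in the Klein model lie in
  affine hyperplanes just as Euclidean ones do. The strict signs at \<open>y1\<close> and
  \<open>y2\<close> drive both injectivity and rigidity of isometries.\<close>

lemma bisector:
  fixes y1 y2 :: "'a::euclidean_space"
  assumes y1: "y1 \<in> model_space G" and y2: "y2 \<in> model_space G" and ne: "y1 \<noteq> y2"
  obtains a b where "\<And>z. \<lbrakk>z \<in> model_space G; model_dist G y1 z = model_dist G y2 z\<rbrakk> \<Longrightarrow> a \<bullet> z = b"
    and "a \<bullet> y1 < b" and "b < a \<bullet> y2"
proof (cases G)
  case Euclidean
  define a b where "a = 2 *\<^sub>R (y2 - y1)" and "b = y2 \<bullet> y2 - y1 \<bullet> y1"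
  have sq: "(dist y z)\<^sup>2 = y \<bullet> y - 2 * (y \<bullet> z) + z \<bullet> z" for y z :: 'a
    by (simp add: dist_norm power2_norm_eq_inner algebra_simps inner_commute)
  have pos: "0 < y1 \<bullet> y1 - 2 * (y1 \<bullet> y2) + y2 \<bullet> y2"
    using ne sq[of y1 y2] by (metis zero_less_power2 dist_eq_0_iff)
  show ?thesis
  proof
    fix z assume "model_dist G y1 z = model_dist G y2 z"
    then have "(dist y1 z)\<^sup>2 = (dist y2 z)\<^sup>2" by (simp add: Euclidean)
    then show "a \<bullet> z = b" by (simp add: sq a_def b_def algebra_simps)
  next
    show "a \<bullet> y1 < b" "b < a \<bullet> y2"
      using pos by (simp_all add: a_def b_def algebra_simps inner_commute)
  qed
next
  case Hyperbolic
  define s1 s2 where "s1 = sqrt (1 - (norm y1)\<^sup>2)" and "s2 = sqrt (1 - (norm y2)\<^sup>2)"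
  have B: "y1 \<in> ball 0 1" "y2 \<in> ball 0 1" using y1 y2 Hyperbolic by auto
  have s: "0 < s1" "0 < s2" "1 - y1 \<bullet> y1 = s1 * s1" "1 - y2 \<bullet> y2 = s2 * s2"
    using klein_factor_pos[OF B(1)] klein_factor_pos[OF B(2)]
    by (simp_all add: s1_def s2_def power2_norm_eq_inner)
  define a b where "a = y2 /\<^sub>R s2 - y1 /\<^sub>R s1" and "b = 1 / s2 - 1 / s1"
  have lin: "a \<bullet> z - b = (1 - y1 \<bullet> z) / s1 - (1 - y2 \<bullet> z) / s2" for z
    by (simp add: a_def b_def algebra_simps divide_simps)
  \<comment> \<open>The cosh of the distance between two distinct points exceeds 1; multiplying by
    \<open>s1\<close> or \<open>s2\<close> gives the two strict signs.\<close>
  have gt: "1 < (1 - y1 \<bullet> y2) / (s1 * s2)"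
    using klein_cosh_gt_1[OF B ne] by (simp add: klein_cosh_def s1_def s2_def)
  show ?thesis
  proof
    fix z assume z: "z \<in> model_space G" and "model_dist G y1 z = model_dist G y2 z"
    then have zB: "z \<in> ball 0 1" and "klein_cosh y1 z = klein_cosh y2 z"
      using B Hyperbolic by (auto simp: klein_dist_eq_iff)
    then have "(1 - y1 \<bullet> z) / s1 = (1 - y2 \<bullet> z) / s2"
      using klein_factor_pos(2)[OF zB] s
      by (simp add: klein_cosh_def divide_simps flip: s1_def s2_def)
    then show "a \<bullet> z = b" using lin[of z] by simp
  next
    have gt': "s1 < (1 - y1 \<bullet> y2) / s2" "s2 < (1 - y1 \<bullet> y2) / s1"
      using s gt by (simp_all add: pos_less_divide_eq mult.commute)
    show "a \<bullet> y1 < b"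
      using lin[of y1] s gt' by (simp add: inner_commute)
    show "b < a \<bullet> y2"
      using lin[of y2] s gt' by simp
  qed
qed

text \<open>Two distinct points with the same image would each be at the same model distance from
  both of them, hence on their own bisector, whereas \<open>bisector\<close> puts them strictly on
  either side of it.\<close>

lemma isometry_inj_on:
  fixes j :: "'a::euclidean_space \<Rightarrow> 'a"
  assumes "isometry G A B j" and "A \<subseteq> model_space G"
  shows "inj_on j A"
proof (rule inj_onI, rule ccontr)
  fix x y assume xy: "x \<in> A" "y \<in> A" "j x = j y" "x \<noteq> y"
  then have "model_dist G y x = model_dist G x x" "model_dist G x y = model_dist G y y"
    using assms(1) unfolding isometry_def by metis+
  moreover have "x \<in> model_space G" "y \<in> model_space G" using xy assms by auto
  ultimately show False using bisector[of x G y] xy(4) by (metis less_irrefl)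
qed

text \<open>In the hyperbolic case the preserved quantity \<open>klein_cosh z x\<close> tends to 1
  as \<open>z\<close> tends to \<open>x\<close>, and \<open>klein_cosh_bound\<close> at the images
  turns this into Euclidean convergence.\<close>

lemma isometry_continuous_on:
  fixes j :: "'a::euclidean_space \<Rightarrow> 'a"
  assumes j: "isometry G A B j" and A: "A \<subseteq> model_space G" and B: "B \<subseteq> model_space G"
  shows "continuous_on A j"
proof (cases G)
  case Euclidean
  then show ?thesis using j by (auto simp: isometry_def continuous_on_iff)
next
  case Hyperbolic
  show ?thesis unfolding continuous_on_def
  proof
    fix x assume x: "x \<in> A"
    have b: "z \<in> A \<Longrightarrow> z \<in> ball 0 1" "z \<in> A \<Longrightarrow> j z \<in> ball 0 1" for z
      using A B j Hyperbolic by (auto simp: isometry_def)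
    have bound: "dist (j z) (j x) \<le> sqrt ((klein_cosh z x)\<^sup>2 - 1)" if z: "z \<in> A" for z
    proof -
      have "klein_cosh (j z) (j x) = klein_cosh z x"
        using j x z b Hyperbolic by (simp add: isometry_def klein_dist_eq_iff)
      then show ?thesis
        using klein_cosh_bound[of "j z" "j x"] x z b by (simp add: dist_norm real_le_rsqrt)
    qed
    have "((\<lambda>z. klein_cosh z x) \<longlongrightarrow> klein_cosh x x) (at x within A)"
      unfolding klein_cosh_def using klein_factor_pos[OF b(1)[OF x]] by (intro tendsto_intros) auto
    then have "((\<lambda>z. sqrt ((klein_cosh z x)\<^sup>2 - 1)) \<longlongrightarrow> sqrt (1\<^sup>2 - 1)) (at x within A)"
      by (intro tendsto_intros) (simp add: klein_cosh_self[OF b(1)[OF x]])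
    then have "((\<lambda>z. sqrt ((klein_cosh z x)\<^sup>2 - 1)) \<longlongrightarrow> 0) (at x within A)" by simp
    then have "((\<lambda>z. dist (j z) (j x)) \<longlongrightarrow> 0) (at x within A)"
    proof (rule Lim_null_comparison[rotated])
      have "\<forall>\<^sub>F z in at x within A. z \<in> A"
        by (simp add: eventually_at_filter)
      then show "\<forall>\<^sub>F z in at x within A. norm (dist (j z) (j x)) \<le> sqrt ((klein_cosh z x)\<^sup>2 - 1)"
      proof (rule eventually_mono)
        fix z assume "z \<in> A"
        from bound[OF this] show "norm (dist (j z) (j x)) \<le> sqrt ((klein_cosh z x)\<^sup>2 - 1)"
          by (simp only: real_norm_def abs_of_nonneg[OF zero_le_dist])
      qed
    qed
    then show "(j \<longlongrightarrow> j x) (at x within A)" by (subst tendsto_dist_iff)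
  qed
qed

lemma isometry_compose:
  assumes "isometry G A B u" and "isometry G B C v"
  shows "isometry G A C (\<lambda>x. v (u x))"
proof -
  have "(\<lambda>x. v (u x)) ` A = v ` (u ` A)" by (simp add: image_image)
  then show ?thesis using assms by (auto simp: isometry_def)
qed

lemma isometry_inv_into:
  assumes u: "isometry G A B u" and "A \<subseteq> model_space G"
  shows "isometry G B A (inv_into A u)"
proof -
  have b: "bij_betw u A B"
    using u isometry_inj_on[OF assms] by (simp add: isometry_def bij_betw_def)
  show ?thesis unfolding isometry_def
  proof (intro conjI ballI)
    show "inv_into A u ` B = A" using bij_betw_inv_into[OF b] by (simp add: bij_betw_def)
    fix x y assume "x \<in> B" "y \<in> B"
    then show "model_dist G (inv_into A u x) (inv_into A u y) = model_dist G x y"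
      using b u by (auto simp: bij_betw_def isometry_def)
  qed
qed

lemma isometry_cong:
  assumes "isometry G A B u" and "\<And>x. x \<in> A \<Longrightarrow> v x = u x"
  shows "isometry G A B v"
proof -
  have "v ` A = u ` A" using assms(2) by (rule image_cong[OF refl])
  then show ?thesis using assms unfolding isometry_def by simp
qed

section \<open>Extending isometries\<close>

text \<open>The closure is included so that ideal vertices have images. Images of segments are
  recorded rather than affinity, which projective maps of the Klein model lack in general.\<close>

definition motion :: "geometry \<Rightarrow> ('a::euclidean_space \<Rightarrow> 'a) \<Rightarrow> bool" where
  "motion G g \<longleftrightarrow>
     isometry G (model_space G) (model_space G) g \<and>
     bij_betw g (closure (model_space G)) (closure (model_space G)) \<and>
     (\<forall>a\<in>closure (model_space G). \<forall>b\<in>closure (model_space G).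
        g ` closed_segment a b = closed_segment (g a) (g b))"

text \<open>A Witt-type argument, with \<open>B\<close> left abstract so that it covers the inner
  product and the Lorentz form. A basis \<open>E\<close> inside \<open>C\<close> determines
  \<open>L\<close>; bilinearity makes \<open>L\<close> preserve \<open>B\<close>, nondegeneracy
  makes it injective, and finite dimension makes it onto.\<close>

lemma form_extension:
  fixes B :: "'v::euclidean_space \<Rightarrow> 'v \<Rightarrow> real"
  assumes bil: "bilinear B" and nondeg: "\<And>v. (\<And>w. B v w = 0) \<Longrightarrow> v = 0"
    and span: "span C = UNIV" and J: "\<And>x y. \<lbrakk>x \<in> C; y \<in> C\<rbrakk> \<Longrightarrow> B (J x) (J y) = B x y"
  obtains L where "linear L" and "\<And>x. x \<in> C \<Longrightarrow> L x = J x"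
    and "\<And>v w. B (L v) (L w) = B v w" and "bij L"
proof -
  obtain E where E0: "E \<subseteq> C" "independent E" "C \<subseteq> span E"
    using maximal_independent_subset[of C] by blast
  have "span C \<subseteq> span E" using E0(3) subspace_span by (rule span_minimal)
  then have E: "E \<subseteq> C" "independent E" "span E = UNIV" using E0 span by auto
  obtain L where L: "linear L" "\<And>x. x \<in> E \<Longrightarrow> L x = J x"
    using linear_independent_extend[OF E(2)] by metis
  have bil2: "bilinear (\<lambda>v w. B (L v) (L w))"
    using bil L(1) linear_compose[OF L(1), of "\<lambda>x. B x (L w)" for w]
      linear_compose[OF L(1), of "B (L v)" for v]
    by (simp add: bilinear_def o_def)
  have pres: "B (L v) (L w) = B v w" for v w
  proof (rule bilinear_eq[OF bil2 bil, of UNIV E UNIV E])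
    show "B (L x) (L y) = B x y" if "x \<in> E" "y \<in> E" for x y
      using that subsetD[OF E(1)] L(2) J by simp
  qed (simp_all add: E(3))
  have "inj L"
  proof (rule injI)
    fix v w assume "L v = L w"
    then have "B (v - w) u = 0" for u
      using pres[of "v - w" u] linear_diff[OF L(1)] bilinear_lzero[OF bil] by simp
    then show "v = w" using nondeg[of "v - w"] by simp
  qed
  then have surj: "surj L" using L(1) linear_injective_imp_surjective by blast
  have "L x = J x" if x: "x \<in> C" for x
  proof -
    \<comment> \<open>The defect \<open>J x - L x\<close> is orthogonal to \<open>L e\<close> for
      each basis vector \<open>e\<close>, because \<open>J\<close> and \<open>L\<close> preserve
      \<open>B\<close> and agree at \<open>e\<close>. By surjectivity of \<open>L\<close> it is then
      orthogonal to everything.\<close>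
    have "B (J x - L x) (L w) = 0" for w
    proof -
      have "w \<in> span E" using E by simp
      then show ?thesis
      proof (induction rule: span_induct_alt)
        case base
        then show ?case using linear_0[OF L(1)] bilinear_rzero[OF bil] by simp
      next
        case (step c e w)
        have "B (J x - L x) (L e) = 0"
          using J[OF x, of e] subsetD[OF E(1) step(1)] L(2)[OF step(1)] pres[of x e]
            bilinear_lsub[OF bil] by simp
        then show ?case
          using step(2) linear_add[OF L(1)] linear_scale[OF L(1)] bilinear_radd[OF bil] bilinear_rmul[OF bil]
          by simp
      qed
    qed
    then have "B (J x - L x) u = 0" for u using surj by (metis surjD)
    then show ?thesis using nondeg[of "J x - L x"] by simp
  qed
  then show ?thesis using that L(1) pres \<open>inj L\<close> surj by (meson bij_def)
qed

lemma subspace_eq_UNIV: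
  fixes S :: "'a::euclidean_space set"
  assumes S: "subspace S" and e: "0 < e" "ball 0 e \<subseteq> S"
  shows "S = UNIV"
proof -
  have "v \<in> S" for v
  proof (cases "v = 0")
    case False
    have "(e / (2 * norm v)) *\<^sub>R v \<in> S"
      using e False by (intro subsetD[OF e(2)]) simp
    then have "(2 * norm v / e) *\<^sub>R (e / (2 * norm v)) *\<^sub>R v \<in> S"
      using S by (rule subspace_scale[rotated])
    then show ?thesis using e False by simp
  qed (use S in \<open>simp add: subspace_0\<close>)
  then show ?thesis by blast
qed

section \<open>Extension of Euclidean isometries\<close>

lemma euclidean_isometry_extends:
  fixes j :: "'a::euclidean_space \<Rightarrow> 'a"
  assumes j: "isometry Euclidean A B j" and A: "interior A \<noteq> {}"
  obtains g where "motion Euclidean g" and "\<And>x. x \<in> A \<Longrightarrow> g x = j x"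
proof -
  obtain c e where c: "0 < e" "ball c e \<subseteq> A" using A by (metis ex_in_conv mem_interior)
  then have cA: "c \<in> A" by auto
  \<comment> \<open>Moving \<open>c\<close> and \<open>j c\<close> to the origin leaves a linear
    extension problem.\<close>
  define J where "J v = j (v + c) - j c" for v
  define C where "C = (\<lambda>x. x - c) ` A"
  have "ball 0 e \<subseteq> C"
  proof
    fix v :: 'a assume "v \<in> ball 0 e"
    then have "v + c \<in> A" using c(2) by (auto simp: dist_norm)
    then show "v \<in> C" by (auto simp: C_def intro: image_eqI[of _ _ "v + c"])
  qed
  then have span: "span C = UNIV"
    using subspace_eq_UNIV[OF subspace_span c(1)] span_superset[of C] by blast
  have Jinner: "J v \<bullet> J w = v \<bullet> w" if vw: "v \<in> C" "w \<in> C" for v w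
  proof -
    have d: "dist (j x) (j y) = dist x y" if "x \<in> A" "y \<in> A" for x y
      using j that by (simp add: isometry_def)
    \<comment> \<open>These three norms determine the inner product by polarisation.\<close>
    have n: "norm (J v) = norm v" "norm (J w) = norm w" "norm (J v - J w) = norm (v - w)"
      using vw d cA by (auto simp: C_def J_def dist_norm)
    then show ?thesis
      using dot_norm_neg[of "J v" "J w"] dot_norm_neg[of v w] by simp
  qed
  have nondeg: "v = 0" if "\<And>w. v \<bullet> w = 0" for v :: 'a
    using that inner_eq_zero_iff by blast
  have bil: "bilinear (inner :: 'a \<Rightarrow> 'a \<Rightarrow> real)"
    by (simp add: bilinear_def bounded_linear.linear bounded_linear_inner_left bounded_linear_inner_right)
  obtain L where L: "linear L" "\<And>x. x \<in> C \<Longrightarrow> L x = J x" "\<And>v w. L v \<bullet> L w = v \<bullet> w" "bij L"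
    using form_extension[of inner C J, OF bil nondeg span Jinner] by metis
  define g where "g x = j c + L (x - c)" for x
  have gA: "g x = j x" if "x \<in> A" for x
    using L(2)[of "x - c"] that by (simp add: g_def J_def C_def)
  have norm_L: "norm (L v) = norm v" for v using L(3) by (simp add: norm_eq_sqrt_inner)
  have "bij g"
  proof -
    have "g = (\<lambda>x. j c + x) \<circ> L \<circ> (\<lambda>x. x - c)" by (auto simp: g_def)
    then show ?thesis using L(4)
      by (simp add: bij_comp bij_plus bij_diff_right)
  qed
  moreover have "dist (g x) (g y) = dist x y" for x y
    using norm_L[of "x - y"] linear_diff[OF L(1), of "x - c" "y - c"]
    by (simp add: g_def dist_norm)
  moreover have "g ` closed_segment a b = closed_segment (g a) (g b)" for a b
  proof -
    have "g = (\<lambda>x. (j c - L c) + x) \<circ> L" by (auto simp: g_def linear_diff[OF L(1)])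
    then show ?thesis
      by (simp only: image_comp[symmetric] closed_segment_linear_image[OF L(1), symmetric] o_apply
            closed_segment_translation)
  qed
  ultimately have "motion Euclidean g"
    by (simp add: motion_def isometry_def bij_is_surj)
  then show ?thesis using that gA by blast
qed

section \<open>Lorentz geometry behind the Klein model\<close>

definition lorentz :: "'a::euclidean_space \<times> real \<Rightarrow> 'a \<times> real \<Rightarrow> real" where
  "lorentz v w = fst v \<bullet> fst w - snd v * snd w"

lemma lorentz_Pair: "lorentz (x, s) (y, t) = x \<bullet> y - s * t"
  by (simp add: lorentz_def)

lemma lorentz_scaleR:
  "lorentz (r *\<^sub>R v) w = r * lorentz v w" "lorentz v (r *\<^sub>R w) = r * lorentz v w"
  by (simp_all add: lorentz_def algebra_simps)

lemma bilinear_lorentz: "bilinear (lorentz :: 'a::euclidean_space \<times> real \<Rightarrow> _)"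
  by (auto simp: bilinear_def lorentz_def algebra_simps intro!: linearI)

lemma lorentz_nondegenerate:
  fixes v :: "'a::euclidean_space \<times> real"
  assumes "\<And>w. lorentz v w = 0"
  shows "v = 0"
proof -
  have "fst v \<bullet> fst v + (snd v)\<^sup>2 = 0"
    using assms[of "(fst v, - snd v)"] by (simp add: lorentz_def power2_eq_square)
  then have "fst v \<bullet> fst v = 0 \<and> (snd v)\<^sup>2 = 0"
    using inner_ge_zero[of "fst v"] zero_le_power2[of "snd v"] by linarith
  then show ?thesis by (simp add: prod_eq_iff)
qed

lemma future_directed:
  fixes u w :: "'a::euclidean_space \<times> real"
  assumes w: "lorentz w w \<le> 0" and u: "lorentz u u < 0" "0 < snd u" and wu: "lorentz w u < 0"
  shows "0 < snd w"
proof (rule ccontr)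
  assume "\<not> 0 < snd w"
  then have s: "snd w \<le> 0" by simp
  have "(norm (fst w))\<^sup>2 \<le> (- snd w)\<^sup>2" "(norm (fst u))\<^sup>2 < (snd u)\<^sup>2"
    using w u by (simp_all add: lorentz_def power2_norm_eq_inner power2_eq_square[of "snd _"])
  then have "norm (fst w) \<le> - snd w" "norm (fst u) \<le> snd u"
    using s u by (auto intro: power2_le_imp_le less_imp_le)
  then have "norm (fst w) * norm (fst u) \<le> - snd w * snd u"
    using s by (intro mult_mono) auto
  moreover have "- (norm (fst w) * norm (fst u)) \<le> fst w \<bullet> fst u"
    using Cauchy_Schwarz_ineq2[of "fst w" "fst u"] by linarith
  ultimately show False using wu by (simp add: lorentz_def)
qed

text \<open>For \<open>x\<close> in the open ball this is the point of the ray through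
  \<open>(x, 1)\<close> on the upper sheet where the form equals -1.\<close>

definition hyperboloid :: "'a::euclidean_space \<Rightarrow> 'a \<times> real" where
  "hyperboloid x = (x, 1) /\<^sub>R sqrt (1 - (norm x)\<^sup>2)"

lemma lorentz_hyperboloid: "lorentz (hyperboloid x) (hyperboloid y) = - klein_cosh x y"
  by (simp add: hyperboloid_def lorentz_Pair klein_cosh_def divide_simps)

text \<open>The action of \<open>L\<close> on rays, read off on the slice of height 1. For Lorentz
  maps the height is positive over the whole closed ball by
  \<open>lorentz_map_future\<close>.\<close>

definition projective :: "('a::euclidean_space \<times> real \<Rightarrow> 'a \<times> real) \<Rightarrow> 'a \<Rightarrow> 'a" where
  "projective L x = fst (L (x, 1)) /\<^sub>R snd (L (x, 1))"

text \<open>The last clause makes \<open>L\<close> preserve the future cone.\<close>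

definition lorentz_map :: "('a::euclidean_space \<times> real \<Rightarrow> 'a \<times> real) \<Rightarrow> bool" where
  "lorentz_map L \<longleftrightarrow> linear L \<and> bij L \<and> (\<forall>v w. lorentz (L v) (L w) = lorentz v w) \<and>
     (\<exists>c\<in>ball 0 1. \<exists>c'\<in>ball 0 1. L (hyperboloid c) = hyperboloid c')"

lemma lorentz_mapD: "lorentz_map L \<Longrightarrow> lorentz (L v) (L w) = lorentz v w"
  unfolding lorentz_map_def by blast

lemma lorentz_map_inv:
  assumes "lorentz_map L"
  shows "lorentz_map (inv_into UNIV L)"
proof -
  have b: "linear L" "bij L" using assms by (auto simp: lorentz_map_def)
  have L: "L (inv_into UNIV L v) = v" "inv_into UNIV L (L v) = v" for v
    using b(2) by (simp_all add: bij_is_surj surj_f_inv_f bij_is_inj inv_f_f)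
  have "linear (inv_into UNIV L)" using b linear_injective_on_subspace_0 inj_linear_imp_inv_linear bij_is_inj
    by blast
  moreover have "lorentz (inv_into UNIV L v) (inv_into UNIV L w) = lorentz v w" for v w
    using assms L by (metis lorentz_map_def)
  ultimately show ?thesis using assms L bij_imp_bij_inv[OF b(2)]
    unfolding lorentz_map_def by metis
qed

text \<open>The point \<open>c'\<close> fixes the time orientation: \<open>(x, 1)\<close> is causal
  and pairs negatively with \<open>hyperboloid c\<close>, and \<open>L\<close> keeps both facts. The
  pairing is strictly negative even for \<open>x\<close> on the sphere because \<open>c\<close> lies
  in the open ball.\<close>

lemma lorentz_map_future:
  assumes L: "lorentz_map L" and x: "x \<in> cball 0 1"
  shows "0 < snd (L (x, 1))"
proof -
  obtain c c' where c: "c \<in> ball 0 1" "c' \<in> ball 0 1" "L (hyperboloid c) = hyperboloid c'"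
    using L by (auto simp: lorentz_map_def)
  note pres = lorentz_mapD[OF L]
  show ?thesis
  proof (rule future_directed)
    show "lorentz (L (x, 1)) (L (x, 1)) \<le> 0"
      using x by (simp add: pres lorentz_Pair power_le_one flip: power2_norm_eq_inner)
    show "lorentz (hyperboloid c') (hyperboloid c') < 0"
      using klein_cosh_pos[of c' c'] c by (simp add: lorentz_hyperboloid)
    show "0 < snd (hyperboloid c')"
      using klein_factor_pos(2)[OF c(2)] by (simp add: hyperboloid_def)
    have "lorentz (L (x, 1)) (hyperboloid c') = lorentz (x, 1) (hyperboloid c)"
      using pres[of "(x, 1)" "hyperboloid c"] c by simp
    also have "\<dots> = (x \<bullet> c - 1) / sqrt (1 - (norm c)\<^sup>2)"
      by (simp add: hyperboloid_def lorentz_Pair divide_simps)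
    also have "\<dots> < 0"
      using klein_factor_pos(2)[OF c(1)] inner_less_one[of x c] x c by (intro divide_neg_pos) auto
    finally show "lorentz (L (x, 1)) (hyperboloid c') < 0" .
  qed
qed

lemma projective_eq:
  assumes "lorentz_map L" and "x \<in> cball 0 1"
  shows "L (x, 1) = snd (L (x, 1)) *\<^sub>R (projective L x, 1)"
  using lorentz_map_future[OF assms] by (simp add: projective_def prod_eq_iff)

lemma projective_scaleR:
  assumes "linear L" and "v = r *\<^sub>R (x, 1)" and "r \<noteq> 0"
  shows "projective L x = fst (L v) /\<^sub>R snd (L v)"
  using assms linear_scale[OF assms(1), of r "(x, 1)"] by (simp add: projective_def)

text \<open>Invariance of the form at \<open>(x, 1)\<close>. It gives preservation of the open and
  of the closed ball, and it compares the normalising factors of two hyperboloid lifts.\<close>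

lemma projective_norm:
  assumes L: "lorentz_map L" and x: "x \<in> cball 0 1"
  shows "(snd (L (x, 1)))\<^sup>2 * (1 - (norm (projective L x))\<^sup>2) = 1 - (norm x)\<^sup>2"
proof -
  have "lorentz (L (x, 1)) (L (x, 1)) = lorentz (x, 1) (x, 1)" by (rule lorentz_mapD[OF L])
  then show ?thesis
    by (subst (asm) (1 2) projective_eq[OF L x])
      (simp add: lorentz_scaleR lorentz_Pair power2_norm_eq_inner power2_eq_square[of "snd _"]
        algebra_simps)
qed

lemma projective_in_ball:
  assumes L: "lorentz_map L"
  shows "x \<in> cball 0 1 \<Longrightarrow> projective L x \<in> cball 0 1"
    and "x \<in> ball 0 1 \<Longrightarrow> projective L x \<in> ball 0 1"
proof -
  have *: "(norm y \<le> 1 \<longleftrightarrow> 0 \<le> 1 - (norm y)\<^sup>2)" "(norm y < 1 \<longleftrightarrow> 0 < 1 - (norm y)\<^sup>2)" for y :: 'a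
    by (simp_all add: abs_square_le_1 abs_square_less_1)
  define r where "r = (snd (L (x, 1)))\<^sup>2"
  have eq: "r * (1 - (norm (projective L x))\<^sup>2) = 1 - (norm x)\<^sup>2" and r: "0 < r"
    if "x \<in> cball 0 1"
    using projective_norm[OF L that] lorentz_map_future[OF L that] by (simp_all add: r_def)
  show "projective L x \<in> cball 0 1" if x: "x \<in> cball 0 1"
  proof -
    have "0 \<le> r * (1 - (norm (projective L x))\<^sup>2)" using eq[OF x] *(1)[of x] x by simp
    then show ?thesis using r[OF x] *(1)[of "projective L x"] by (simp add: zero_le_mult_iff)
  qed
  show "projective L x \<in> ball 0 1" if x: "x \<in> ball 0 1"
  proof -
    have xc: "x \<in> cball 0 1" using x by simp
    have "0 < r * (1 - (norm (projective L x))\<^sup>2)" using eq[OF xc] *(2)[of x] x by simp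
    then show ?thesis using r[OF xc] *(2)[of "projective L x"] by (simp add: zero_less_mult_iff)
  qed
qed

lemma projective_inv:
  assumes L: "lorentz_map L" and x: "x \<in> cball 0 1"
  shows "projective (inv_into UNIV L) (projective L x) = x"
proof -
  have "inv_into UNIV L (L (x, 1)) = (x, 1)" using L by (simp add: lorentz_map_def bij_is_inj)
  then show ?thesis
    using projective_scaleR[OF _ projective_eq[OF L x], of "inv_into UNIV L"] lorentz_map_inv[OF L]
      lorentz_map_future[OF L x] by (simp add: lorentz_map_def)
qed

text \<open>\<open>L\<close> respects convex combinations of vectors of height 1; returning to
  height 1 multiplies the weights by the heights \<open>p\<close> and \<open>q\<close> and divides
  by \<open>r\<close>. Positive heights keep the new weights in the unit interval, so the segment is
  only reparametrised.\<close>

lemma projective_segment_subset: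
  assumes L: "lorentz_map L" and ab: "a \<in> cball 0 1" "b \<in> cball 0 1"
  shows "projective L ` closed_segment a b \<subseteq> closed_segment (projective L a) (projective L b)"
proof
  fix y assume "y \<in> projective L ` closed_segment a b"
  then obtain u where u: "0 \<le> u" "u \<le> 1" and y: "y = projective L ((1 - u) *\<^sub>R a + u *\<^sub>R b)"
    by (auto simp: closed_segment_def)
  define x where "x = (1 - u) *\<^sub>R a + u *\<^sub>R b"
  define p q r where "p = snd (L (a, 1))" and "q = snd (L (b, 1))" and "r = snd (L (x, 1))"
  have x: "x \<in> cball 0 1"
    using convexD_alt[OF convex_cball ab u] by (simp add: x_def)
  have lin: "linear L" using L by (simp add: lorentz_map_def)
  have "(x, 1) = (1 - u) *\<^sub>R (a, 1::real) + u *\<^sub>R (b, 1)" by (simp add: x_def)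
  then have Lx: "L (x, 1) = (1 - u) *\<^sub>R L (a, 1) + u *\<^sub>R L (b, 1)"
    by (simp only: linear_add[OF lin] linear_scale[OF lin])
  have pos: "0 < p" "0 < q" "0 < r"
    using lorentz_map_future[OF L] ab x by (simp_all add: p_def q_def r_def)
  have r: "r = (1 - u) * p + u * q" by (simp add: p_def q_def r_def Lx)
  have "r *\<^sub>R projective L x = (1 - u) *\<^sub>R (p *\<^sub>R projective L a) + u *\<^sub>R (q *\<^sub>R projective L b)"
  proof -
    have fst_eq: "fst (L (z, 1)) = snd (L (z, 1)) *\<^sub>R projective L z" if "z \<in> cball 0 1" for z
      by (subst projective_eq[OF L that]) simp
    have "fst (L (x, 1)) = (1 - u) *\<^sub>R fst (L (a, 1)) + u *\<^sub>R fst (L (b, 1))"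
      by (simp add: Lx)
    then show ?thesis
      by (simp only: fst_eq[OF x] fst_eq[OF ab(1)] fst_eq[OF ab(2)] p_def q_def r_def)
  qed
  then have "(1 / r) *\<^sub>R (r *\<^sub>R projective L x)
      = (1 / r) *\<^sub>R ((1 - u) *\<^sub>R (p *\<^sub>R projective L a) + u *\<^sub>R (q *\<^sub>R projective L b))"
    by simp
  then have "projective L x
      = (((1 - u) * p) / r) *\<^sub>R projective L a + ((u * q) / r) *\<^sub>R projective L b"
    using pos(3) by (simp add: scaleR_add_right)
  moreover have "((1 - u) * p) / r = 1 - (u * q) / r"
    using pos r by (simp add: field_simps)
  moreover have "0 \<le> (u * q) / r" "(u * q) / r \<le> 1"
    using pos u r by (auto simp: divide_simps)
  ultimately show "y \<in> closed_segment (projective L a) (projective L b)"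
    by (auto simp: closed_segment_def y x_def)
qed

lemma motion_projective:
  assumes L: "lorentz_map L"
  shows "motion Hyperbolic (projective L)"
proof -
  note L' = lorentz_map_inv[OF L]
  have LL: "inv_into UNIV (inv_into UNIV L) = L" using L by (simp add: lorentz_map_def inv_inv_eq)
  have inv1: "projective (inv_into UNIV L) (projective L x) = x" if "x \<in> cball 0 1" for x
    using projective_inv[OF L that] .
  have inv2: "projective L (projective (inv_into UNIV L) x) = x" if "x \<in> cball 0 1" for x
    using projective_inv[OF L' that] by (simp add: LL)
  have bij: "bij_betw (projective L) (cball 0 1) (cball 0 1)"
    by (rule bij_betw_byWitness[where f' = "projective (inv_into UNIV L)"])
      (use inv1 inv2 projective_in_ball(1)[OF L] projective_in_ball(1)[OF L'] in auto)
  have surj: "projective L ` ball 0 1 = ball 0 1"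
  proof
    show "projective L ` ball 0 1 \<subseteq> ball 0 1" using projective_in_ball(2)[OF L] by blast
    show "ball 0 1 \<subseteq> projective L ` ball 0 1"
    proof
      fix x :: 'a assume x: "x \<in> ball 0 1"
      then show "x \<in> projective L ` ball 0 1"
        using projective_in_ball(2)[OF L' x] inv2[of x] by (intro image_eqI[of _ _ "projective (inv_into UNIV L) x"]) auto
    qed
  qed
  \<comment> \<open>Lifting to the hyperboloid intertwines \<open>projective L\<close> with
    \<open>L\<close>: the height \<open>r\<close> cancels against the change of the normalising
    factor. Invariance of the form then becomes invariance of \<open>klein_cosh\<close>.\<close>
  have hyp: "hyperboloid (projective L x) = L (hyperboloid x)" if x: "x \<in> ball 0 1" for x
  proof -
    define r where "r = snd (L (x, 1))"
    have xc: "x \<in> cball 0 1" using x by simp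
    have r: "0 < r" using lorentz_map_future[OF L xc] by (simp add: r_def)
    have "sqrt (1 - (norm x)\<^sup>2) = r * sqrt (1 - (norm (projective L x))\<^sup>2)"
      using r by (simp add: real_sqrt_mult flip: projective_norm[OF L xc] r_def)
    moreover have "L (hyperboloid x) = L (x, 1) /\<^sub>R sqrt (1 - (norm x)\<^sup>2)"
      using L by (simp add: hyperboloid_def lorentz_map_def linear_scale del: scaleR_Pair)
    ultimately show ?thesis
      using r by (subst (asm) projective_eq[OF L xc]) (simp add: hyperboloid_def flip: r_def)
  qed
  have "klein_dist (projective L x) (projective L y) = klein_dist x y"
    if "x \<in> ball 0 1" "y \<in> ball 0 1" for x y
  proof -
    have "klein_cosh (projective L x) (projective L y)
        = - lorentz (L (hyperboloid x)) (L (hyperboloid y))"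
      by (simp only: lorentz_hyperboloid hyp[symmetric] that minus_minus)
    then show ?thesis
      by (simp only: lorentz_mapD[OF L] lorentz_hyperboloid klein_dist_eq minus_minus)
  qed
  moreover have "projective L ` closed_segment a b = closed_segment (projective L a) (projective L b)"
    if ab: "a \<in> cball 0 1" "b \<in> cball 0 1" for a b
  proof
    show "projective L ` closed_segment a b \<subseteq> closed_segment (projective L a) (projective L b)"
      by (rule projective_segment_subset[OF L ab])
    note ab' = projective_in_ball(1)[OF L ab(1)] projective_in_ball(1)[OF L ab(2)]
    show "closed_segment (projective L a) (projective L b) \<subseteq> projective L ` closed_segment a b"
    proof
      fix y assume y: "y \<in> closed_segment (projective L a) (projective L b)"
      then have "y \<in> cball 0 1" using closed_segment_subset[OF ab' convex_cball] by blast
      \<comment> \<open>The reverse inclusion is the forward one for the inverse map.\<close>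
      moreover have "projective (inv_into UNIV L) y \<in> closed_segment a b"
        using projective_segment_subset[OF L' ab'] y inv1 ab by auto
      ultimately show "y \<in> projective L ` closed_segment a b"
        using inv2 by (metis image_eqI)
    qed
  qed
  ultimately show ?thesis
    using bij surj by (simp add: motion_def isometry_def)
qed

lemma hyperbolic_isometry_extends:
  fixes j :: "'a::euclidean_space \<Rightarrow> 'a"
  assumes j: "isometry Hyperbolic A B j" and A: "interior A \<noteq> {}"
    and AX: "A \<subseteq> ball 0 1" and BX: "B \<subseteq> ball 0 1"
  obtains g where "motion Hyperbolic g" and "\<And>x. x \<in> A \<Longrightarrow> g x = j x"
proof -
  obtain c e where c: "0 < e" "ball c e \<subseteq> A" using A by (metis ex_in_conv mem_interior)
  then have cA: "c \<in> A" by auto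
  have jX: "j x \<in> ball 0 1" if "x \<in> A" for x using that j BX by (auto simp: isometry_def)
  define C where "C = hyperboloid ` A"
  \<comment> \<open>Dividing by the last coordinate recovers a Klein point from its lift, so on
    lifts \<open>J\<close> is \<open>j\<close>.\<close>
  define J where "J v = hyperboloid (j (fst v /\<^sub>R snd v))" for v :: "'a \<times> real"
  have J: "J (hyperboloid x) = hyperboloid (j x)" if "x \<in> A" for x
    using klein_factor_pos(2)[of x] that AX by (auto simp: J_def hyperboloid_def)
  have span1: "(x, 1) \<in> span C" if x: "x \<in> A" for x
  proof -
    have "sqrt (1 - (norm x)\<^sup>2) *\<^sub>R hyperboloid x \<in> span C"
      using x by (intro span_scale span_base) (simp add: C_def)
    then show ?thesis using klein_factor_pos(2)[of x] x AX by (auto simp: hyperboloid_def)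
  qed
  \<comment> \<open>Differences of vectors \<open>(x, 1)\<close> with \<open>x\<close> near
    \<open>c\<close> produce all small horizontal vectors; \<open>(c, 1)\<close> supplies the
    remaining dimension.\<close>
  have "subspace {v. (v, 0) \<in> span C}"
    by (rule subspaceI)
      (use span_add[of _ C] span_scale[of _ C] span_zero[of C] in \<open>fastforce simp: zero_prod_def\<close>)+
  moreover have "ball 0 e \<subseteq> {v. (v, 0) \<in> span C}"
  proof
    fix v :: 'a assume "v \<in> ball 0 e"
    then have "v + c \<in> A" using c(2) by (auto simp: dist_norm)
    then have "(v + c, 1) - (c, 1) \<in> span C" using span1 cA by (blast intro: span_diff)
    then show "v \<in> {v. (v, 0) \<in> span C}" by simp
  qed
  ultimately have v0: "(v, 0) \<in> span C" for v
    using subspace_eq_UNIV[OF _ c(1)] by blast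
  have "v \<in> span C" for v
  proof -
    have "(fst v - snd v *\<^sub>R c, 0) + snd v *\<^sub>R (c, 1) \<in> span C"
      using v0 span1[OF cA] by (intro span_add span_scale)
    then show ?thesis by simp
  qed
  then have span: "span C = UNIV" by blast
  have Jl: "lorentz (J v) (J w) = lorentz v w" if vw: "v \<in> C" "w \<in> C" for v w
  proof -
    obtain x y where xy: "x \<in> A" "y \<in> A" "v = hyperboloid x" "w = hyperboloid y"
      using vw unfolding C_def by blast
    have "klein_dist (j x) (j y) = klein_dist x y" using j xy by (simp add: isometry_def)
    then show ?thesis
      using xy J AX jX by (auto simp: lorentz_hyperboloid klein_dist_eq_iff subset_iff)
  qed
  obtain L where L: "linear L" "\<And>x. x \<in> C \<Longrightarrow> L x = J x"
      "\<And>v w. lorentz (L v) (L w) = lorentz v w" "bij L"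
    using form_extension[of lorentz C J, OF bilinear_lorentz lorentz_nondegenerate span Jl] by metis
  have LA: "L (hyperboloid x) = hyperboloid (j x)" if "x \<in> A" for x
    using L(2)[of "hyperboloid x"] J that by (simp add: C_def)
  have lm: "lorentz_map L"
    unfolding lorentz_map_def using L LA[OF cA] cA AX jX[OF cA] by blast
  have "projective L x = j x" if x: "x \<in> A" for x
  proof -
    have "projective L x = fst (L (hyperboloid x)) /\<^sub>R snd (L (hyperboloid x))"
      by (rule projective_scaleR[OF L(1)])
        (use klein_factor_pos(2)[of x] x AX in \<open>auto simp: hyperboloid_def\<close>)
    then show ?thesis
      using klein_factor_pos(2)[OF jX[OF x]] by (simp add: LA x) (simp add: hyperboloid_def)
  qed
  then show ?thesis using that motion_projective[OF lm] by blast
qed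

lemma isometry_extends:
  fixes j :: "'a::euclidean_space \<Rightarrow> 'a"
  assumes "isometry G A B j" and "A \<subseteq> model_space G" and "B \<subseteq> model_space G"
    and "interior A \<noteq> {}"
  obtains g where "motion G g" and "\<And>x. x \<in> A \<Longrightarrow> g x = j x"
proof (cases G)
  case Euclidean
  then show ?thesis using euclidean_isometry_extends[of A B j] assms that by metis
next
  case Hyperbolic
  then have "A \<subseteq> ball 0 1" "B \<subseteq> ball 0 1" using assms by simp_all
  then show ?thesis using hyperbolic_isometry_extends[of A B j] assms that Hyperbolic by metis
qed

section \<open>Motions and polyhedra\<close>

lemma model_space_subset_closure: "model_space G \<subseteq> closure (model_space G)"
  by (rule closure_subset)

lemma motion_isometry: "motion G g \<Longrightarrow> isometry G (model_space G) (model_space G) g"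
  by (simp add: motion_def)

lemma motion_image_model_space: "motion G g \<Longrightarrow> g ` model_space G = model_space G"
  by (simp add: motion_def isometry_def)

lemma motion_inj_on: "motion G g \<Longrightarrow> inj_on g (closure (model_space G))"
  by (simp add: motion_def bij_betw_def)

lemma motion_inj_on_model_space: "motion G g \<Longrightarrow> inj_on g (model_space G)"
  by (meson motion_inj_on inj_on_subset model_space_subset_closure)

lemma motion_continuous_on: "motion G g \<Longrightarrow> continuous_on (model_space G) g"
  using isometry_continuous_on[OF motion_isometry] by blast

lemma motion_segment:
  assumes "motion G g" and "a \<in> closure (model_space G)" and "b \<in> closure (model_space G)"
  shows "g ` closed_segment a b = closed_segment (g a) (g b)"
  using assms by (simp add: motion_def)

lemma isometry_subset:
  assumes "isometry G A B g" and "S \<subseteq> A"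
  shows "isometry G S (g ` S) g"
  using assms by (auto simp: isometry_def)

lemma motion_convex_image:
  assumes g: "motion G g" and S: "convex S" "S \<subseteq> closure (model_space G)"
  shows "convex (g ` S)"
  unfolding convex_contains_segment
proof (intro ballI)
  fix a b assume "a \<in> g ` S" "b \<in> g ` S"
  then obtain x y where xy: "x \<in> S" "y \<in> S" "a = g x" "b = g y" by blast
  then have "closed_segment a b = g ` closed_segment x y"
    using motion_segment[OF g, of x y] S(2) by auto
  also have "\<dots> \<subseteq> g ` S" using S(1) xy closed_segment_subset by (intro image_mono) auto
  finally show "closed_segment a b \<subseteq> g ` S" .
qed

text \<open>Only images of segments are available, so both inclusions use minimality of the hull.
  For the first, the preimage \<open>?W\<close> of the target hull is convex because segments go to
  segments.\<close>

lemma motion_hull_image: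
  fixes V :: "'a::euclidean_space set"
  assumes g: "motion G g" and V: "V \<subseteq> closure (model_space G)"
  shows "g ` (convex hull V) = convex hull (g ` V)"
proof
  have cc: "convex (closure (model_space G :: 'a set))" by (intro convex_closure convex_model_space)
  then have H: "convex hull V \<subseteq> closure (model_space G)" using V by (rule hull_minimal[rotated])
  let ?W = "{x \<in> closure (model_space G). g x \<in> convex hull (g ` V)}"
  have "closed_segment a b \<subseteq> ?W" if ab: "a \<in> ?W" "b \<in> ?W" for a b
  proof -
    have "g ` closed_segment a b \<subseteq> convex hull (g ` V)"
      using motion_segment[OF g, of a b] closed_segment_subset[OF _ _ convex_convex_hull[of "g ` V"]] ab
      by simp
    moreover have "closed_segment a b \<subseteq> closure (model_space G)"
      using ab closed_segment_subset[OF _ _ cc] by simp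
    ultimately show ?thesis by blast
  qed
  then have "convex ?W" by (simp only: convex_contains_segment) blast
  moreover have "V \<subseteq> ?W" using V hull_subset[of "g ` V" convex] by blast
  ultimately have "convex hull V \<subseteq> ?W" by (rule hull_minimal[rotated])
  then show "g ` (convex hull V) \<subseteq> convex hull (g ` V)" by blast
  have "convex (g ` (convex hull V))" by (rule motion_convex_image[OF g convex_convex_hull H])
  moreover have "g ` V \<subseteq> g ` (convex hull V)" by (intro image_mono hull_subset)
  ultimately show "convex hull (g ` V) \<subseteq> g ` (convex hull V)" by (rule hull_minimal[rotated])
qed

lemma motion_polytope_image:
  assumes g: "motion G g" and P: "polytope P" "P \<subseteq> closure (model_space G)"
  shows "polytope (g ` P)"
proof -
  obtain V where V: "finite V" "P = convex hull V" using P(1) by (auto simp: polytope_def)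
  then have "V \<subseteq> closure (model_space G)" using P(2) hull_subset[of V convex] by blast
  then show ?thesis using V motion_hull_image[OF g] by (auto simp: polytope_def)
qed

text \<open>One inclusion is invariance of domain, from continuity and injectivity of
  \<open>g\<close>; the other pulls the interior of the image back by continuity.\<close>

lemma motion_interior_image:
  fixes S :: "'a::euclidean_space set"
  assumes g: "motion G g" and S: "S \<subseteq> model_space G"
  shows "interior (g ` S) = g ` interior S"
proof
  have iS: "interior S \<subseteq> model_space G" using S interior_subset by blast
  have "open (g ` interior S)"
    using motion_continuous_on[OF g] motion_inj_on_model_space[OF g] iS
    by (intro invariance_of_domain) (auto intro: continuous_on_subset inj_on_subset)
  then show "g ` interior S \<subseteq> interior (g ` S)"
    by (intro interior_maximal image_mono interior_subset)
  define W where "W = model_space G \<inter> g -` interior (g ` S)"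
  have "open W" unfolding W_def
    by (intro continuous_open_preimage motion_continuous_on[OF g] open_model_space open_interior)
  moreover have "W \<subseteq> S"
  proof
    fix x assume "x \<in> W"
    then have "x \<in> model_space G" "g x \<in> g ` S" using interior_subset by (auto simp: W_def)
    then show "x \<in> S" using motion_inj_on_model_space[OF g] S by (auto dest: inj_onD)
  qed
  ultimately have "W \<subseteq> interior S" by (rule interior_maximal[rotated])
  moreover have "interior (g ` S) \<subseteq> g ` W"
  proof
    fix y assume y: "y \<in> interior (g ` S)"
    then obtain x where "x \<in> S" "y = g x" using interior_subset by blast
    then show "y \<in> g ` W" using y S by (auto simp: W_def)
  qed
  ultimately show "interior (g ` S) \<subseteq> g ` interior S" by blast
qed

lemma convex_polyhedronD:
  assumes "convex_polyhedron G p"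
  shows "p \<subseteq> model_space G" "convex p" "interior p \<noteq> {}"
  using assms convex_model_space[of G]
  by (auto simp: convex_polyhedron_def intro: convex_Int dest: polytope_imp_convex)

lemma motion_convex_polyhedron:
  assumes g: "motion G g" and p: "convex_polyhedron G p"
  shows "convex_polyhedron G (g ` p)"
proof -
  obtain P where P: "polytope P" "P \<subseteq> closure (model_space G)" "p = P \<inter> model_space G"
    using p by (auto simp: convex_polyhedron_def)
  have "g ` p = g ` P \<inter> g ` model_space G"
    unfolding P(3) by (rule inj_on_image_Int[OF motion_inj_on[OF g] P(2) model_space_subset_closure])
  then have "g ` p = g ` P \<inter> model_space G" by (simp add: motion_image_model_space[OF g])
  moreover have "g ` P \<subseteq> closure (model_space G)"
    using g P(2) by (auto simp: motion_def bij_betw_def)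
  moreover have "interior (g ` p) \<noteq> {}"
    using motion_interior_image[OF g] convex_polyhedronD[OF p] by simp
  ultimately show ?thesis
    using motion_polytope_image[OF g P(1,2)] unfolding convex_polyhedron_def by blast
qed

text \<open>As \<open>g\<close> need not be affine, dimensions are compared topologically: the image
  is convex and homeomorphic to \<open>S\<close>, and homeomorphic convex sets have the same affine
  dimension.\<close>

lemma motion_aff_dim:
  fixes S :: "'a::euclidean_space set"
  assumes g: "motion G g" and S: "convex S" "S \<subseteq> model_space G"
  shows "aff_dim (g ` S) = aff_dim S"
proof -
  have iso: "isometry G S (g ` S) g" by (rule isometry_subset[OF motion_isometry[OF g] S(2)])
  have gS: "g ` S \<subseteq> model_space G" using S(2) motion_image_model_space[OF g] by blast
  have "homeomorphism S (g ` S) g (inv_into S g)"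
    using isometry_continuous_on[OF iso S(2) gS]
      isometry_continuous_on[OF isometry_inv_into[OF iso S(2)] gS S(2)]
      isometry_inj_on[OF iso S(2)]
    by (auto simp: homeomorphism_def)
  then have "S homeomorphic g ` S" by (auto simp: homeomorphic_def)
  moreover have "convex (g ` S)"
    using motion_convex_image[OF g S(1)] S(2) model_space_subset_closure by blast
  ultimately show ?thesis using homeomorphic_convex_sets[OF S(1)] by metis
qed

lemma motion_facet_image:
  fixes f p :: "'a::euclidean_space set"
  assumes g: "motion G g" and p: "convex p" "p \<subseteq> model_space G" and f: "f facet_of p"
  shows "g ` f facet_of g ` p"
proof -
  have f': "f face_of p" "f \<noteq> {}" "aff_dim f = aff_dim p - 1" using f by (auto simp: facet_of_def)
  have fp: "f \<subseteq> p" "convex f" using f'(1) by (auto simp: face_of_def)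
  have pc: "p \<subseteq> closure (model_space G)" using p(2) model_space_subset_closure by blast
  have "g ` f face_of g ` p"
    unfolding face_of_def
  proof (intro conjI ballI impI)
    show "g ` f \<subseteq> g ` p" using fp by blast
    show "convex (g ` f)" using motion_convex_image[OF g fp(2)] fp(1) pc by blast
  next
    fix a' b' x' assume "a' \<in> g ` p" "b' \<in> g ` p" "x' \<in> g ` f" and seg: "x' \<in> open_segment a' b'"
    then obtain a b x where abx: "a \<in> p" "b \<in> p" "x \<in> f" "a' = g a" "b' = g b" "x' = g x" by blast
    have "g x \<in> g ` closed_segment a b"
      using seg abx motion_segment[OF g, of a b] pc by (auto simp: open_segment_def)
    moreover have "closed_segment a b \<subseteq> p" using abx p(1) by (intro closed_segment_subset)
    ultimately have "x \<in> closed_segment a b"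
      using inj_on_image_mem_iff[OF motion_inj_on[OF g]] abx fp(1) pc by (meson subset_iff)
    moreover have "x \<noteq> a" "x \<noteq> b" using seg abx by (auto simp: open_segment_def)
    ultimately have "x \<in> open_segment a b" by (simp add: open_segment_def)
    then have "a \<in> f \<and> b \<in> f" using f'(1) abx unfolding face_of_def by blast
    then show "a' \<in> g ` f" "b' \<in> g ` f" using abx by auto
  qed
  moreover have "aff_dim (g ` f) = aff_dim (g ` p) - 1"
    using motion_aff_dim[OF g] fp p f'(3) by auto
  ultimately show ?thesis using f'(2) by (simp add: facet_of_def)
qed

lemma isometry_facet_image:
  assumes j: "isometry G p p' j" and p: "convex_polyhedron G p" and p': "p' \<subseteq> model_space G"
    and f: "f facet_of p"
  shows "j ` f facet_of p'"
proof -
  note pD = convex_polyhedronD[OF p]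
  obtain g where g: "motion G g" "\<And>x. x \<in> p \<Longrightarrow> g x = j x"
    using isometry_extends[OF j pD(1) p' pD(3)] by blast
  have "f \<subseteq> p" using f by (simp add: facet_of_imp_subset)
  then have "g ` f = j ` f" "g ` p = j ` p" using g(2) by (auto intro!: image_cong)
  moreover have "j ` p = p'" using j by (simp add: isometry_def)
  ultimately have "g ` f = j ` f" "g ` p = p'" by simp_all
  then show ?thesis using motion_facet_image[OF g(1) pD(2,1) f] by simp
qed

lemma isometry_interior_image:
  assumes j: "isometry G p p' j" and p: "convex_polyhedron G p" and p': "p' \<subseteq> model_space G"
  shows "j ` interior p = interior p'"
proof -
  note pD = convex_polyhedronD[OF p]
  obtain g where g: "motion G g" "\<And>x. x \<in> p \<Longrightarrow> g x = j x"
    using isometry_extends[OF j pD(1) p' pD(3)] by blast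
  have "g ` p = j ` p" "g ` interior p = j ` interior p"
    using g(2) interior_subset[of p] by (auto intro!: image_cong)
  then show ?thesis
    using motion_interior_image[OF g(1) pD(1)] j by (simp add: isometry_def)
qed

lemma isometry_model_space_motion:
  fixes g :: "'a::euclidean_space \<Rightarrow> 'a"
  assumes "isometry G (model_space G) (model_space G) g"
  obtains h where "motion G h" and "\<And>x. x \<in> model_space G \<Longrightarrow> h x = g x"
  using isometry_extends[OF assms order_refl order_refl interior_model_space] by blast

lemma isometry_convex_polyhedron:
  assumes g: "isometry G (model_space G) (model_space G) g" and p: "convex_polyhedron G p"
  shows "convex_polyhedron G (g ` p)"
proof -
  obtain h where h: "motion G h" "\<And>x. x \<in> model_space G \<Longrightarrow> h x = g x"
    using isometry_model_space_motion[OF g] by blast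
  then have "h ` p = g ` p" using convex_polyhedronD(1)[OF p] by (auto intro!: image_cong)
  then show ?thesis using motion_convex_polyhedron[OF h(1) p] by simp
qed

section \<open>Convex bodies sharing a facet\<close>

text \<open>Were there points of \<open>t\<close> strictly on both sides of the hyperplane spanned
  by \<open>f\<close>, the segment joining them would cross it inside \<open>f\<close>, and the face
  property would force its ends into \<open>f\<close>.\<close>

lemma facet_halfspace:
  fixes t :: "'a::euclidean_space set"
  assumes t: "convex t" "interior t \<noteq> {}" and f: "f facet_of t"
  obtains a b where "a \<noteq> 0" and "affine hull f = {x. a \<bullet> x = b}" and "t \<subseteq> {x. a \<bullet> x \<le> b}"
proof -
  have f': "f face_of t" "f \<noteq> {}" "aff_dim f = aff_dim t - 1" using f by (auto simp: facet_of_def)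
  have "aff_dim t = DIM('a)" using t(2) by (rule aff_dim_nonempty_interior)
  then obtain a b where ab: "a \<noteq> 0" "affine hull f = {x. a \<bullet> x = b}"
    using f'(3) aff_dim_eq_hyperplane[of f] by auto
  have fH: "f = affine hull f \<inter> t" by (rule face_of_imp_eq_affine_Int[OF t(1) f'(1)])
  have one_side: "\<not> (a \<bullet> u < b \<and> b < a \<bullet> v)" if uv: "u \<in> t" "v \<in> t" for u v
  proof
    assume s: "a \<bullet> u < b \<and> b < a \<bullet> v"
    \<comment> \<open>The parameter at which the segment from \<open>u\<close> to \<open>v\<close>
      meets the hyperplane.\<close>
    define r where "r = (b - a \<bullet> u) / (a \<bullet> v - a \<bullet> u)"
    define c where "c = (1 - r) *\<^sub>R u + r *\<^sub>R v"
    have r: "0 < r" "r < 1" using s by (auto simp: r_def divide_simps)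
    have ac: "a \<bullet> c = b"
    proof -
      have "a \<bullet> c = a \<bullet> u + r * (a \<bullet> v - a \<bullet> u)" by (simp add: c_def algebra_simps)
      then show ?thesis using s by (simp add: r_def)
    qed
    have "c \<in> t" using convexD_alt[OF t(1) uv] r by (simp add: c_def)
    then have "c \<in> f" using fH ac ab(2) by blast
    moreover have "c \<in> open_segment u v"
      unfolding in_segment(2) using r s by (auto simp: c_def)
    ultimately have "u \<in> f" using f'(1) uv unfolding face_of_def by blast
    then have "a \<bullet> u = b" using fH ab(2) by blast
    then show False using s by simp
  qed
  show ?thesis
  proof (cases "\<exists>u\<in>t. a \<bullet> u < b")
    case True
    then have "t \<subseteq> {x. a \<bullet> x \<le> b}" using one_side by force
    then show ?thesis using that ab by blast
  next
    case False
    then have "t \<subseteq> {x. (- a) \<bullet> x \<le> - b}" by force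
    moreover have "affine hull f = {x. (- a) \<bullet> x = - b}" using ab(2) by simp
    ultimately show ?thesis using that[of "- a" "- b"] ab(1) by simp
  qed
qed

lemma interior_halfspace_less:
  fixes t :: "'a::euclidean_space set"
  assumes "a \<noteq> 0" and "t \<subseteq> {x. a \<bullet> x \<le> b}" and "x \<in> interior t"
  shows "a \<bullet> x < b"
  using interior_mono[OF assms(2)] assms(1,3) interior_halfspace_le[of a b] by auto

text \<open>The cone from an interior point over a neighbourhood of \<open>x\<close> in the facet contains a
  half-ball around \<open>x\<close>.\<close>

lemma half_neighbourhood:
  fixes t :: "'a::euclidean_space set"
  assumes t: "convex t" and f: "f \<subseteq> t" and H: "affine hull f = {y. a \<bullet> y = b}"
    and x: "x \<in> rel_interior f" and c: "c \<in> t" "a \<bullet> c < b"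
  obtains e where "0 < e" and "ball x e \<inter> {y. a \<bullet> y \<le> b} \<subseteq> t"
proof -
  obtain d where d: "0 < d" "ball x d \<inter> affine hull f \<subseteq> f"
    using x by (auto simp: mem_rel_interior_ball)
  have ax: "a \<bullet> x = b"
    using x H rel_interior_subset[of f] hull_subset[of f affine] by blast
  \<comment> \<open>Chosen so that \<open>z y\<close> is the point where the ray from
    \<open>c\<close> through \<open>y\<close> meets the hyperplane; \<open>1 \<le> s y\<close> then
    places \<open>y\<close> between \<open>c\<close> and \<open>z y\<close>.\<close>
  define s where "s y = (b - a \<bullet> c) / (a \<bullet> y - a \<bullet> c)" for y
  define z where "z y = c + s y *\<^sub>R (y - c)" for y
  have zx: "z x = x" using c(2) by (simp add: z_def s_def ax)
  have "isCont z x"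
    unfolding z_def s_def using c(2) ax by (intro continuous_intros) auto
  then have "\<forall>\<^sub>F y in nhds x. z y \<in> ball x d"
    using topological_tendstoD[of z "z x" "nhds x" "ball x d"] d(1)
    by (simp only: isCont_def tendsto_at_iff_tendsto_nhds[of z x]) (simp add: zx)
  moreover have "\<forall>\<^sub>F y in nhds x. a \<bullet> c < a \<bullet> y"
    by (rule eventually_nhds_in_open[of "{y. a \<bullet> c < a \<bullet> y}" x, simplified])
      (use c(2) ax open_halfspace_gt in auto)
  ultimately have "\<forall>\<^sub>F y in nhds x. z y \<in> ball x d \<and> a \<bullet> c < a \<bullet> y"
    by (rule eventually_conj)
  then obtain e where e: "0 < e" "\<And>y. dist y x < e \<Longrightarrow> z y \<in> ball x d \<and> a \<bullet> c < a \<bullet> y"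
    by (auto simp: eventually_nhds_metric)
  have "ball x e \<inter> {y. a \<bullet> y \<le> b} \<subseteq> t"
  proof
    fix y assume y: "y \<in> ball x e \<inter> {y. a \<bullet> y \<le> b}"
    then have zy: "z y \<in> ball x d" "a \<bullet> c < a \<bullet> y" using e(2)[of y] by (auto simp: dist_commute)
    have s: "1 \<le> s y" using zy(2) y by (simp add: s_def)
    have "a \<bullet> z y = a \<bullet> c + s y * (a \<bullet> y - a \<bullet> c)" by (simp add: z_def algebra_simps)
    also have "\<dots> = b" using zy(2) by (simp add: s_def)
    finally have "z y \<in> f" using d(2) H zy(1) by blast
    then have zt: "z y \<in> t" using f by blast
    have "y = (1 - 1 / s y) *\<^sub>R c + (1 / s y) *\<^sub>R z y"
      using s by (simp add: z_def algebra_simps)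
    moreover have "(1 - 1 / s y) *\<^sub>R c + (1 / s y) *\<^sub>R z y \<in> t"
      using s by (intro convexD_alt[OF t c(1) zt]) auto
    ultimately show "y \<in> t" by simp
  qed
  then show ?thesis using that e(1) by blast
qed

text \<open>If \<open>t2\<close> had a point strictly on the side of \<open>t1\<close>, both bodies
  would contain a half-ball on that side around a relative interior point of \<open>f\<close>, and
  their interiors would meet.\<close>

lemma opposite_sides:
  fixes t1 t2 :: "'a::euclidean_space set"
  assumes t1: "convex t1" "interior t1 \<noteq> {}" and f1: "f facet_of t1"
    and t2: "convex t2" "interior t2 \<noteq> {}" and f2: "f facet_of t2"
    and disj: "interior t1 \<inter> interior t2 = {}"
    and H: "affine hull f = {x. a \<bullet> x = b}" "a \<noteq> 0" "t1 \<subseteq> {x. a \<bullet> x \<le> b}"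
  shows "t2 \<subseteq> {x. b \<le> a \<bullet> x}"
proof -
  obtain a' b' where H': "a' \<noteq> 0" "affine hull f = {x. a' \<bullet> x = b'}" "t2 \<subseteq> {x. a' \<bullet> x \<le> b'}"
    using facet_halfspace[OF t2 f2] by metis
  have f: "f \<noteq> {}" "convex f" "f \<subseteq> t1" "f \<subseteq> t2"
    using f1 f2 by (auto simp: facet_of_def face_of_def)
  then obtain x where x: "x \<in> rel_interior f" using rel_interior_eq_empty by blast
  then have xf: "x \<in> f" using rel_interior_subset by blast
  have ax: "a \<bullet> x = b" using xf H(1) hull_subset[of f affine] by blast
  have one_side: "\<not> (\<exists>c\<in>t2. a \<bullet> c < b)"
  proof
    assume "\<exists>c\<in>t2. a \<bullet> c < b"
    then obtain c2 where c2: "c2 \<in> t2" "a \<bullet> c2 < b" by blast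
    obtain c1 where "c1 \<in> interior t1" using t1(2) by blast
    then have c1: "c1 \<in> t1" "a \<bullet> c1 < b"
      using interior_halfspace_less[OF H(2,3)] interior_subset by blast+
    obtain e1 where e1: "0 < e1" "ball x e1 \<inter> {y. a \<bullet> y \<le> b} \<subseteq> t1"
      using half_neighbourhood[OF t1(1) f(3) H(1) x c1] by blast
    obtain e2 where e2: "0 < e2" "ball x e2 \<inter> {y. a \<bullet> y \<le> b} \<subseteq> t2"
      using half_neighbourhood[OF t2(1) f(4) H(1) x c2] by blast
    define U where "U = ball x (min e1 e2) \<inter> {y. a \<bullet> y < b}"
    have "open U" unfolding U_def by (intro open_Int open_ball open_halfspace_lt)
    moreover have "U \<subseteq> t1" "U \<subseteq> t2" using e1(2) e2(2) by (auto simp: U_def subset_iff)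
    ultimately have "U \<subseteq> interior t1 \<inter> interior t2" by (simp add: interior_maximal)
    \<comment> \<open>A witness that the open half-ball \<open>U\<close> is nonempty: half the
      radius from \<open>x\<close> against the normal.\<close>
    moreover have "x - (min e1 e2 / (2 * norm a)) *\<^sub>R a \<in> U"
    proof -
      have "0 < a \<bullet> a" using H(2) by simp
      then show ?thesis
        using H(2) e1(1) e2(1) by (auto simp: U_def ax dist_norm inner_diff_right divide_simps)
    qed
    ultimately show False using disj by blast
  qed
  then show ?thesis by force
qed

text \<open>A hyperplane has only two sides: \<open>t2\<close> and \<open>t3\<close> both lie
  opposite \<open>t1\<close>, so if their interiors were disjoint, \<open>t3\<close> would also lie
  opposite \<open>t2\<close> and thus inside the hyperplane.\<close>

lemma same_side_overlap:
  fixes t2 t3 :: "'a::euclidean_space set"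
  assumes t1: "convex t1" "interior t1 \<noteq> {}" and f1: "f facet_of t1"
    and t2: "convex t2" "interior t2 \<noteq> {}" and f2: "f facet_of t2"
    and t3: "convex t3" "interior t3 \<noteq> {}" and f3: "f facet_of t3"
    and disj: "interior t1 \<inter> interior t2 = {}" "interior t1 \<inter> interior t3 = {}"
  shows "interior t2 \<inter> interior t3 \<noteq> {}"
proof
  assume 0: "interior t2 \<inter> interior t3 = {}"
  obtain a b where H: "a \<noteq> 0" "affine hull f = {x. a \<bullet> x = b}" "t1 \<subseteq> {x. a \<bullet> x \<le> b}"
    using facet_halfspace[OF t1 f1] by metis
  have "t2 \<subseteq> {x. b \<le> a \<bullet> x}" by (rule opposite_sides[OF t1 f1 t2 f2 disj(1) H(2,1,3)])
  moreover have s3: "t3 \<subseteq> {x. b \<le> a \<bullet> x}" by (rule opposite_sides[OF t1 f1 t3 f3 disj(2) H(2,1,3)])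
  ultimately have "t2 \<subseteq> {x. (- a) \<bullet> x \<le> - b}" by auto
  moreover have "affine hull f = {x. (- a) \<bullet> x = - b}" using H(2) by simp
  ultimately have "t3 \<subseteq> {x. - b \<le> (- a) \<bullet> x}"
    using opposite_sides[OF t2 f2 t3 f3 0, of "- a" "- b"] H(1) by simp
  then have "t3 \<subseteq> {x. a \<bullet> x \<le> b}" by auto
  moreover obtain x where "x \<in> interior t3" using t3(2) by blast
  ultimately have "a \<bullet> x < b" "x \<in> t3"
    using interior_halfspace_less[OF H(1)] interior_subset by blast+
  then show False using s3 by force
qed

text \<open>Two images of a point of \<open>t\<close> would be separated by the bisector, which is the hyperplane
  of the common facet.\<close>

lemma isometries_agree_across_facet:
  fixes u v :: "'a::euclidean_space \<Rightarrow> 'a"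
  assumes u: "isometry G t t2 u" and v: "isometry G t t3 v" and t: "convex_polyhedron G t"
    and f: "f facet_of t" and uv: "\<And>x. x \<in> f \<Longrightarrow> u x = v x"
    and t2: "convex t2" "interior t2 \<noteq> {}" "t2 \<subseteq> model_space G"
    and t3: "convex t3" "interior t3 \<noteq> {}" "t3 \<subseteq> model_space G"
    and t1: "convex t1" "interior t1 \<noteq> {}" and f1: "u ` f facet_of t1"
    and disj: "interior t1 \<inter> interior t2 = {}" "interior t1 \<inter> interior t3 = {}"
    and y: "y \<in> t"
  shows "u y = v y"
proof (rule ccontr)
  assume ne: "u y \<noteq> v y"
  have f2: "u ` f facet_of t2" by (rule isometry_facet_image[OF u t t2(3) f])
  have "u ` f = v ` f" using uv by (intro image_cong) auto
  then have f3: "u ` f facet_of t3" using isometry_facet_image[OF v t t3(3) f] by simp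
  have yu: "u y \<in> t2" "v y \<in> t3" using u v y by (auto simp: isometry_def)
  obtain a b where H: "a \<noteq> 0" "affine hull (u ` f) = {x. a \<bullet> x = b}" "t1 \<subseteq> {x. a \<bullet> x \<le> b}"
    using facet_halfspace[OF t1 f1] by metis
  have s2: "t2 \<subseteq> {x. b \<le> a \<bullet> x}" by (rule opposite_sides[OF t1 f1 t2(1,2) f2 disj(1) H(2,1,3)])
  have s3: "t3 \<subseteq> {x. b \<le> a \<bullet> x}" by (rule opposite_sides[OF t1 f1 t3(1,2) f3 disj(2) H(2,1,3)])
  obtain a' b' where B: "\<And>z. \<lbrakk>z \<in> model_space G; model_dist G (u y) z = model_dist G (v y) z\<rbrakk> \<Longrightarrow> a' \<bullet> z = b'"
    "a' \<bullet> u y < b'" "b' < a' \<bullet> v y"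
    using bisector[OF _ _ ne] yu t2(3) t3(3) by blast
  have a': "a' \<noteq> 0" using B(2,3) by auto
  have "u ` f \<subseteq> {x. a' \<bullet> x = b'}"
  proof
    fix z assume "z \<in> u ` f"
    then obtain x where x: "x \<in> f" "z = u x" "z = v x" using uv by auto
    then have xt: "x \<in> t" using f by (auto simp: facet_of_def face_of_def)
    have "model_dist G (u y) z = model_dist G y x" using u xt y x(2) by (simp add: isometry_def)
    moreover have "model_dist G (v y) z = model_dist G y x" using v xt y x(3) by (simp add: isometry_def)
    moreover have "z \<in> model_space G" using u xt x(2) t2(3) by (auto simp: isometry_def)
    ultimately show "z \<in> {x. a' \<bullet> x = b'}" using B(1) by simp
  qed
  then have sub: "{x. a \<bullet> x = b} \<subseteq> {x. a' \<bullet> x = b'}"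
    unfolding H(2)[symmetric] by (intro hull_minimal affine_hyperplane)
  moreover have "{x. a \<bullet> x = b} \<noteq> {}"
    using f2 H(2) hull_subset[of "u ` f" affine] by (auto simp: facet_of_def)
  \<comment> \<open>An inclusion between hyperplanes is an equality, by dimension.\<close>
  ultimately have eq: "{x. a \<bullet> x = b} = {x. a' \<bullet> x = b'}"
    using H(1) a' by (intro affine_dim_equal affine_hyperplane) auto
  \<comment> \<open>\<open>m\<close> is where the segment between the two images crosses the
    bisector, hence the hyperplane of the facet; yet both ends lie strictly on the side away from
    \<open>t1\<close>.\<close>
  define r where "r = (b' - a' \<bullet> u y) / (a' \<bullet> v y - a' \<bullet> u y)"
  define m where "m = (1 - r) *\<^sub>R u y + r *\<^sub>R v y"
  have r: "0 < r" "r < 1" using B(2,3) by (auto simp: r_def divide_simps)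
  have "a' \<bullet> m = a' \<bullet> u y + r * (a' \<bullet> v y - a' \<bullet> u y)" by (simp add: m_def algebra_simps)
  then have "a' \<bullet> m = b'" using B(2,3) by (simp add: r_def)
  then have "a \<bullet> m = b" using eq by blast
  moreover have "b < a \<bullet> u y" "b < a \<bullet> v y"
  proof -
    have "u y \<notin> {x. a' \<bullet> x = b'}" "v y \<notin> {x. a' \<bullet> x = b'}" using B(2,3) by auto
    then have "a \<bullet> u y \<noteq> b" "a \<bullet> v y \<noteq> b" unfolding eq[symmetric] by auto
    then show "b < a \<bullet> u y" "b < a \<bullet> v y" using s2 s3 yu by (auto simp: subset_iff less_le)
  qed
  then have "(1 - r) * b + r * b < (1 - r) * (a \<bullet> u y) + r * (a \<bullet> v y)"
    using r by (intro add_strict_mono mult_strict_left_mono) auto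
  then have "b < a \<bullet> m" by (simp add: m_def algebra_simps)
  ultimately show False by simp
qed

text \<open>The bodies lie on opposite sides, and each contains the half-ball on its own side around
  \<open>x\<close>; together these fill a ball.\<close>

lemma facet_union_neighbourhood:
  fixes t1 t2 :: "'a::euclidean_space set"
  assumes t1: "convex t1" "interior t1 \<noteq> {}" and f1: "f facet_of t1"
    and t2: "convex t2" "interior t2 \<noteq> {}" and f2: "f facet_of t2"
    and disj: "interior t1 \<inter> interior t2 = {}" and x: "x \<in> rel_interior f"
  shows "x \<in> interior (t1 \<union> t2)"
proof -
  obtain a b where H: "a \<noteq> 0" "affine hull f = {x. a \<bullet> x = b}" "t1 \<subseteq> {x. a \<bullet> x \<le> b}"
    using facet_halfspace[OF t1 f1] by metis
  have "t2 \<subseteq> {x. b \<le> a \<bullet> x}" by (rule opposite_sides[OF t1 f1 t2 f2 disj H(2,1,3)])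
  then have H2: "- a \<noteq> 0" "affine hull f = {x. (- a) \<bullet> x = - b}" "t2 \<subseteq> {x. (- a) \<bullet> x \<le> - b}"
    using H(1,2) by auto
  obtain c1 c2 where "c1 \<in> interior t1" "c2 \<in> interior t2" using t1(2) t2(2) by blast
  then have c: "c1 \<in> t1" "a \<bullet> c1 < b" "c2 \<in> t2" "(- a) \<bullet> c2 < - b"
    using interior_halfspace_less[OF H(1,3)] interior_halfspace_less[OF H2(1,3)] interior_subset
    by blast+
  have f: "f \<subseteq> t1" "f \<subseteq> t2" using f1 f2 by (auto dest: facet_of_imp_subset)
  obtain e1 where e1: "0 < e1" "ball x e1 \<inter> {y. a \<bullet> y \<le> b} \<subseteq> t1"
    using half_neighbourhood[OF t1(1) f(1) H(2) x c(1,2)] by blast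
  obtain e2 where e2: "0 < e2" "ball x e2 \<inter> {y. (- a) \<bullet> y \<le> - b} \<subseteq> t2"
    using half_neighbourhood[OF t2(1) f(2) H2(2) x c(3,4)] by blast
  have "ball x (min e1 e2) \<subseteq> t1 \<union> t2"
  proof
    fix y assume y: "y \<in> ball x (min e1 e2)"
    show "y \<in> t1 \<union> t2"
      by (cases "a \<bullet> y \<le> b") (use y e1(2) e2(2) in \<open>auto simp: subset_iff\<close>)
  qed
  then show ?thesis using e1(1) e2(1) by (auto simp: mem_interior intro!: exI[of _ "min e1 e2"])
qed

text \<open>The codimension 2 sets are the facets of facets of the polytope \<open>P\<close>, where
  finiteness and the description of relative boundaries are available; \<open>t\<close> itself is
  not closed when it has ideal vertices.\<close>

lemma polyhedron_skeleton:
  fixes t :: "'a::euclidean_space set"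
  assumes t: "convex_polyhedron G t"
  obtains \<E> where "finite \<E>" and "\<And>E. E \<in> \<E> \<Longrightarrow> aff_dim E = int DIM('a) - 2"
    and "\<And>z. \<lbrakk>z \<in> t; z \<notin> \<Union>\<E>; z \<notin> interior t\<rbrakk> \<Longrightarrow> \<exists>f. f facet_of t \<and> z \<in> rel_interior f"
proof -
  obtain P where P: "polytope P" "t = P \<inter> model_space G" and int: "interior t \<noteq> {}"
    using t unfolding convex_polyhedron_def by blast
  have "interior t = interior P \<inter> model_space G"
    by (simp add: P(2) interior_open open_model_space)
  then have intP: "interior P \<noteq> {}" using int by blast
  have dim: "aff_dim t = DIM('a)" "aff_dim P = DIM('a)"
    using int intP by (simp_all add: aff_dim_nonempty_interior)
  define \<E> where "\<E> = (\<Union>F\<in>{F. F facet_of P}. {E. E facet_of F})"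
  have poly: "polytope F" if "F facet_of P" for F
    using that P(1) face_of_polytope_polytope facet_of_imp_face_of by blast
  show ?thesis
  proof
    show "finite \<E>"
      unfolding \<E>_def using finite_polytope_facets[OF P(1)] finite_polytope_facets[OF poly] by blast
  next
    fix E assume "E \<in> \<E>"
    then show "aff_dim E = int DIM('a) - 2" using dim(2) by (auto simp: \<E>_def facet_of_def)
  next
    fix z assume z: "z \<in> t" "z \<notin> \<Union>\<E>" "z \<notin> interior t"
    have zX: "z \<in> P" "z \<in> model_space G" using z(1) P(2) by auto
    have "z \<notin> interior P" using z(3) zX \<open>interior t = _\<close> by blast
    then have "z \<in> P - rel_interior P" using zX rel_interior_nonempty_interior[OF intP] by simp
    then obtain F where F: "F facet_of P" "z \<in> F"
      using rel_boundary_of_polyhedron[OF polytope_imp_polyhedron[OF P(1)]] by auto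
    have "z \<in> rel_interior F"
    proof (rule ccontr)
      assume "z \<notin> rel_interior F"
      then have "z \<in> F - rel_interior F" using F(2) by blast
      then obtain E where "E facet_of F" "z \<in> E"
        using rel_boundary_of_polyhedron[OF polytope_imp_polyhedron[OF poly[OF F(1)]]] by auto
      then show False using z(2) F(1) by (auto simp: \<E>_def)
    qed
    then obtain e where e: "0 < e" "ball z e \<inter> affine hull F \<subseteq> F"
      by (auto simp: mem_rel_interior_ball)
    obtain d where d: "0 < d" "ball z d \<subseteq> model_space G"
      using open_model_space zX(2) open_contains_ball by blast
    \<comment> \<open>Since the model space is open and contains \<open>z\<close>, cutting
      \<open>F\<close> with it changes neither the dimension nor the local picture at
      \<open>z\<close>.\<close>
    define f where "f = F \<inter> model_space G"
    have zf: "z \<in> f" using F(2) zX(2) by (simp add: f_def)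
    have "f face_of t"
      unfolding f_def P(2) by (intro face_of_slice convex_model_space facet_of_imp_face_of[OF F(1)])
    moreover have "aff_dim f = aff_dim F"
      unfolding f_def
      by (rule aff_dim_convex_Int_open)
        (use zf polytope_imp_convex[OF poly[OF F(1)]] open_model_space in \<open>auto simp: f_def\<close>)
    ultimately have "f facet_of t"
      using zf F(1) dim by (auto simp: facet_of_def)
    moreover have "ball z (min d e) \<inter> affine hull f \<subseteq> f"
    proof -
      have "affine hull f \<subseteq> affine hull F" by (intro hull_mono) (simp add: f_def)
      then show ?thesis using d(2) e(2) by (auto simp: f_def subset_iff)
    qed
    then have "z \<in> rel_interior f"
      using zf d(1) e(1) by (auto simp: mem_rel_interior_ball intro!: exI[of _ "min d e"])
    ultimately show "\<exists>f. f facet_of t \<and> z \<in> rel_interior f" by blast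
  qed
qed

lemma negligible_aff_dim:
  fixes S :: "'a::euclidean_space set"
  assumes "aff_dim S < DIM('a)"
  shows "negligible S"
proof -
  obtain a b where "a \<noteq> 0" "S \<subseteq> {x. a \<bullet> x = b}" using aff_lowdim_subset_hyperplane[OF assms] .
  then show ?thesis using negligible_hyperplane[of a b] negligible_subset by blast
qed

text \<open>Codimension 2 leaves room for one cone: after \<open>a\<close> is chosen off all sets,
  the affine hull of each \<open>E\<close> with \<open>a\<close> still has codimension at least 1,
  so \<open>b\<close> can avoid all these countably many hulls.\<close>

lemma generic_segment:
  fixes U V :: "'a::euclidean_space set"
  assumes \<E>: "countable \<E>" "\<And>E. E \<in> \<E> \<Longrightarrow> aff_dim E \<le> int DIM('a) - 2"
    and U: "open U" "U \<noteq> {}" and V: "open V" "V \<noteq> {}"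
  obtains a b where "a \<in> U" and "b \<in> V" and "closed_segment a b \<inter> \<Union>\<E> = {}"
proof -
  have "negligible (\<Union>\<E>)"
    by (rule negligible_countable_Union[OF \<E>(1)]) (use \<E>(2) in \<open>fastforce intro: negligible_aff_dim\<close>)
  then obtain a where a: "a \<in> U" "a \<notin> \<Union>\<E>"
    using open_not_negligible[OF U] negligible_subset by blast
  have "negligible (\<Union>((\<lambda>E. affine hull (insert a E)) ` \<E>))"
  proof (rule negligible_countable_Union)
    show "countable ((\<lambda>E. affine hull (insert a E)) ` \<E>)" using \<E>(1) by simp
    fix H assume "H \<in> (\<lambda>E. affine hull (insert a E)) ` \<E>"
    then obtain E where E: "E \<in> \<E>" "H = affine hull (insert a E)" by blast
    have "aff_dim H < DIM('a)"
      using \<E>(2)[OF E(1)] by (simp add: E(2) aff_dim_insert)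
    then show "negligible H" by (rule negligible_aff_dim)
  qed
  then obtain b where bV: "b \<in> V" "b \<notin> \<Union>((\<lambda>E. affine hull (insert a E)) ` \<E>)"
    using open_not_negligible[OF V] negligible_subset by blast
  then have b: "b \<in> V" "\<And>E. E \<in> \<E> \<Longrightarrow> b \<notin> affine hull (insert a E)" by auto
  have "c \<notin> E" if c: "c \<in> closed_segment a b" and E: "E \<in> \<E>" for c E
  proof
    assume cE: "c \<in> E"
    obtain u where u: "0 \<le> u" "u \<le> 1" "c = (1 - u) *\<^sub>R a + u *\<^sub>R b"
      using c by (auto simp: closed_segment_def)
    \<comment> \<open>Since \<open>a\<close> is not in \<open>E\<close>, the point \<open>c\<close>
      differs from \<open>a\<close>, and the line through \<open>a\<close> and \<open>c\<close>
      reaches \<open>b\<close>.\<close>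
    have "u \<noteq> 0" using u(3) cE E a(2) by auto
    then have "b = (1 - 1 / u) *\<^sub>R a + (1 / u) *\<^sub>R c" by (simp add: u(3) algebra_simps)
    moreover have "(1 - 1 / u) *\<^sub>R a + (1 / u) *\<^sub>R c \<in> affine hull (insert a E)"
      using cE by (intro mem_affine affine_affine_hull hull_inc) auto
    ultimately show False using b(2)[OF E] by simp
  qed
  then show ?thesis using that a(1) b(1) by blast
qed

section \<open>Tilings covering a decomposition\<close>

locale tiled_manifold =
  fixes G :: geometry and \<Gamma> :: "('a::euclidean_space \<Rightarrow> 'a) set" and D :: "('a, 's) decomposition"
  assumes covering: "covering_group G \<Gamma>" and decomposes: "decomposes G \<Gamma> D"
begin

abbreviation X :: "'a set" where "X \<equiv> model_space G"

lemma deck_isometry: "\<gamma> \<in> \<Gamma> \<Longrightarrow> isometry G X X \<gamma>"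
  using covering by (simp add: covering_group_def)

lemma deck_in: "\<lbrakk>\<gamma> \<in> \<Gamma>; x \<in> X\<rbrakk> \<Longrightarrow> \<gamma> x \<in> X"
  using deck_isometry by (auto simp: isometry_def)

lemma deck_subgroup: "subgroup \<Gamma> (BijGroup X)"
  using covering by (simp add: covering_group_def)

lemma deck_Bij: "\<gamma> \<in> \<Gamma> \<Longrightarrow> \<gamma> \<in> Bij X"
  using subgroup.subset[OF deck_subgroup] by (auto simp: BijGroup_def)

lemma deck_one: "(\<lambda>x\<in>X. x) \<in> \<Gamma>"
  using subgroup.one_closed[OF deck_subgroup] by (simp add: BijGroup_def)

lemma deck_compose: "\<lbrakk>\<gamma> \<in> \<Gamma>; \<delta> \<in> \<Gamma>\<rbrakk> \<Longrightarrow> compose X \<gamma> \<delta> \<in> \<Gamma>"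
  using subgroup.m_closed[OF deck_subgroup, of \<gamma> \<delta>] deck_Bij by (simp add: BijGroup_def)

lemma deck_inverse:
  assumes "\<gamma> \<in> \<Gamma>"
  obtains \<delta> where "\<delta> \<in> \<Gamma>" and "\<And>x. x \<in> X \<Longrightarrow> \<delta> (\<gamma> x) = x" and "\<And>x. x \<in> X \<Longrightarrow> \<gamma> (\<delta> x) = x"
proof -
  interpret B: group "BijGroup X" by (rule group_BijGroup)
  define \<delta> where "\<delta> = m_inv (BijGroup X) \<gamma>"
  have \<gamma>: "\<gamma> \<in> carrier (BijGroup X)" using subgroup.subset[OF deck_subgroup] assms by blast
  have \<delta>: "\<delta> \<in> \<Gamma>" unfolding \<delta>_def by (rule subgroup.m_inv_closed[OF deck_subgroup assms])
  have "compose X \<delta> \<gamma> = (\<lambda>x\<in>X. x)" "compose X \<gamma> \<delta> = (\<lambda>x\<in>X. x)"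
    using B.l_inv[OF \<gamma>] B.r_inv[OF \<gamma>] deck_Bij[OF assms] deck_Bij[OF \<delta>]
    by (simp_all add: BijGroup_def \<delta>_def)
  then have "\<delta> (\<gamma> x) = x" "\<gamma> (\<delta> x) = x" if "x \<in> X" for x
    using that by (metis compose_eq restrict_apply')+
  then show ?thesis using that \<delta> by blast
qed

lemma deck_free_nbhd:
  assumes "x \<in> X"
  obtains U where "open U" and "x \<in> U" and "U \<subseteq> X"
    and "\<And>\<gamma> y z. \<lbrakk>\<gamma> \<in> \<Gamma>; y \<in> U; \<gamma> y \<in> U; z \<in> X\<rbrakk> \<Longrightarrow> \<gamma> z = z"
proof -
  have "\<forall>x\<in>X. \<exists>U. open U \<and> x \<in> U \<and> U \<subseteq> X \<and>
      (\<forall>\<gamma>\<in>\<Gamma>. \<gamma> \<noteq> \<one>\<^bsub>BijGroup X\<^esub> \<longrightarrow> \<gamma> ` U \<inter> U = {})"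
    using covering unfolding covering_group_def by (elim conjE)
  from bspec[OF this assms] obtain U where U: "open U" "x \<in> U" "U \<subseteq> X"
    and disj: "\<forall>\<gamma>\<in>\<Gamma>. \<gamma> \<noteq> \<one>\<^bsub>BijGroup X\<^esub> \<longrightarrow> \<gamma> ` U \<inter> U = {}"
    by (elim exE conjE)
  have "\<gamma> z = z" if \<gamma>: "\<gamma> \<in> \<Gamma>" "y \<in> U" "\<gamma> y \<in> U" "z \<in> X" for \<gamma> y z
  proof -
    have "\<gamma> = \<one>\<^bsub>BijGroup X\<^esub>" using bspec[OF disj \<gamma>(1)] \<gamma>(2,3) by blast
    then show ?thesis using \<gamma>(4) by (simp add: BijGroup_def)
  qed
  then show ?thesis using that[OF U] by metis
qed

section \<open>Orbits and lifts of maps into the quotient\<close>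

lemma proj_deck:
  assumes "\<gamma> \<in> \<Gamma>" and "x \<in> X"
  shows "proj \<Gamma> (\<gamma> x) = proj \<Gamma> x"
proof -
  obtain \<gamma>' where \<gamma>': "\<gamma>' \<in> \<Gamma>" "\<And>x. x \<in> X \<Longrightarrow> \<gamma>' (\<gamma> x) = x"
    using deck_inverse[OF assms(1)] by metis
  have "\<delta> (\<gamma> x) \<in> proj \<Gamma> x" if "\<delta> \<in> \<Gamma>" for \<delta>
    using deck_compose[OF that assms(1)] assms(2) unfolding proj_def
    by (intro image_eqI[of _ _ "compose X \<delta> \<gamma>"]) (simp_all add: compose_eq)
  moreover have "\<delta> x \<in> proj \<Gamma> (\<gamma> x)" if "\<delta> \<in> \<Gamma>" for \<delta>
    using deck_compose[OF that \<gamma>'(1)] assms deck_in \<gamma>'(2) unfolding proj_def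
    by (intro image_eqI[of _ _ "compose X \<delta> \<gamma>'"]) (simp_all add: compose_eq)
  ultimately show ?thesis by (auto simp: proj_def)
qed

lemma proj_eqD:
  assumes "proj \<Gamma> x = proj \<Gamma> y" and "x \<in> X"
  obtains \<gamma> where "\<gamma> \<in> \<Gamma>" and "x = \<gamma> y"
proof -
  have "x \<in> proj \<Gamma> x" unfolding proj_def
    using deck_one assms(2) by (intro image_eqI[of _ _ "\<lambda>x\<in>X. x"]) auto
  then show ?thesis using that assms(1) by (auto simp: proj_def)
qed

text \<open>The deck transformation is read off at one point. The set where it relates the two lifts
  is closed by continuity and open by the evenly covered neighbourhoods, hence all of the connected
  set \<open>C\<close>.\<close>

lemma lifting_unique_up_to_deck:
  fixes u v :: "'a \<Rightarrow> 'a"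
  assumes C: "connected C" "C \<noteq> {}" and u: "continuous_on C u" "u ` C \<subseteq> X"
    and v: "continuous_on C v" "v ` C \<subseteq> X" and uv: "\<And>x. x \<in> C \<Longrightarrow> proj \<Gamma> (u x) = proj \<Gamma> (v x)"
  obtains \<gamma> where "\<gamma> \<in> \<Gamma>" and "\<And>x. x \<in> C \<Longrightarrow> u x = \<gamma> (v x)"
proof -
  obtain x0 where x0: "x0 \<in> C" using C(2) by blast
  then obtain \<gamma> where \<gamma>: "\<gamma> \<in> \<Gamma>" "u x0 = \<gamma> (v x0)" using proj_eqD[OF uv[OF x0]] u(2) by blast
  obtain \<gamma>' where \<gamma>': "\<gamma>' \<in> \<Gamma>" "\<And>x. x \<in> X \<Longrightarrow> \<gamma>' (\<gamma> x) = x" "\<And>x. x \<in> X \<Longrightarrow> \<gamma> (\<gamma>' x) = x"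
    using deck_inverse[OF \<gamma>(1)] by metis
  define W where "W = {x \<in> C. u x = \<gamma> (v x)}"
  have \<gamma>v: "continuous_on C (\<lambda>x. \<gamma> (v x))"
    using continuous_on_compose2[OF isometry_continuous_on[OF deck_isometry[OF \<gamma>(1)] order_refl order_refl] v] .
  have "W = {x \<in> C. u x - \<gamma> (v x) = 0}" by (simp add: W_def)
  then have "closedin (top_of_set C) W"
    using continuous_closedin_preimage_constant[OF continuous_on_diff[OF u(1) \<gamma>v]] by (simp only:)
  moreover have "openin (top_of_set C) W"
    unfolding openin_subopen[of _ W]
  proof
    fix x assume x: "x \<in> W"
    then have xC: "x \<in> C" "u x = \<gamma> (v x)" by (auto simp: W_def)
    then have "u x \<in> X" using u(2) by blast
    then obtain U where U: "open U" "u x \<in> U" "U \<subseteq> X"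
      "\<And>\<gamma> y z. \<lbrakk>\<gamma> \<in> \<Gamma>; y \<in> U; \<gamma> y \<in> U; z \<in> X\<rbrakk> \<Longrightarrow> \<gamma> z = z"
      using deck_free_nbhd by metis
    define N where "N = (C \<inter> u -` U) \<inter> (C \<inter> (\<lambda>x. \<gamma> (v x)) -` U)"
    have "openin (top_of_set C) N" unfolding N_def
      by (intro openin_Int continuous_openin_preimage_gen u(1) \<gamma>v U(1))
    moreover have "x \<in> N" using xC U(2) by (simp add: N_def)
    moreover have "N \<subseteq> W"
    proof
      fix y assume y: "y \<in> N"
      then have yC: "y \<in> C" "u y \<in> U" "\<gamma> (v y) \<in> U" by (auto simp: N_def)
      have X: "u y \<in> X" "v y \<in> X" "\<gamma> (v y) \<in> X" using yC u(2) v(2) U(3) by auto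
      obtain \<delta> where \<delta>: "\<delta> \<in> \<Gamma>" "u y = \<delta> (v y)" using proj_eqD[OF uv[OF yC(1)] X(1)] .
      \<comment> \<open>This deck transformation carries one point of \<open>U\<close> to another
        point of \<open>U\<close>, so it is trivial on \<open>X\<close>.\<close>
      have "compose X \<delta> \<gamma>' (\<gamma> (v y)) = u y"
        using X \<gamma>' \<delta> by (simp add: compose_eq)
      then have "compose X \<delta> \<gamma>' (\<gamma> (v y)) = \<gamma> (v y)"
        using U(4)[OF deck_compose[OF \<delta>(1) \<gamma>'(1)] yC(3) _ X(3)] yC(2) by simp
      then show "y \<in> W" using \<open>_ = u y\<close> yC(1) by (simp add: W_def)
    qed
    ultimately show "\<exists>T. openin (top_of_set C) T \<and> x \<in> T \<and> T \<subseteq> W" by blast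
  qed
  moreover have "W \<noteq> {}" using x0 \<gamma>(2) by (auto simp: W_def)
  ultimately have "W = C" using C(1) unfolding connected_clopen by blast
  then show ?thesis using that \<gamma>(1) by (auto simp: W_def)
qed

lemma body_polyhedron: "s \<in> cells D \<Longrightarrow> convex_polyhedron G (body D s)"
  using decomposes by (simp add: decomposes_def)

lemma body_subset: "s \<in> cells D \<Longrightarrow> body D s \<subseteq> X"
  using convex_polyhedronD(1)[OF body_polyhedron] .

lemma lift_exists:
  assumes "s \<in> cells D"
  obtains t h where "lifts G \<Gamma> D s t h"
proof -
  have "\<forall>s\<in>cells D. \<exists>t h. lifts G \<Gamma> D s t h"
    using decomposes unfolding decomposes_def by (elim conjE)
  then show ?thesis using that assms by blast
qed

lemma lift_isometry: "lifts G \<Gamma> D s t h \<Longrightarrow> isometry G (body D s) t h"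
  by (simp add: lifts_def)

lemma lift_polyhedron: "lifts G \<Gamma> D s t h \<Longrightarrow> convex_polyhedron G t"
  by (simp add: lifts_def)

lemma lift_image: "lifts G \<Gamma> D s t h \<Longrightarrow> t = h ` body D s"
  by (simp add: lifts_def isometry_def)

lemma lift_in: "\<lbrakk>lifts G \<Gamma> D s t h; x \<in> body D s\<rbrakk> \<Longrightarrow> h x \<in> X"
  using convex_polyhedronD(1)[OF lift_polyhedron] lift_image by blast

lemma lift_proj: "\<lbrakk>lifts G \<Gamma> D s t h; x \<in> body D s\<rbrakk> \<Longrightarrow> proj \<Gamma> (h x) = charmap D s x"
  by (simp add: lifts_def)

lemma lift_continuous:
  assumes "s \<in> cells D" and "lifts G \<Gamma> D s t h"
  shows "continuous_on (body D s) h"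
  using isometry_continuous_on[OF lift_isometry body_subset]
    convex_polyhedronD(1)[OF lift_polyhedron] assms by blast

lemma lift_deck:
  assumes s: "s \<in> cells D" and h: "lifts G \<Gamma> D s t h" and \<gamma>: "\<gamma> \<in> \<Gamma>"
  shows "lifts G \<Gamma> D s (\<gamma> ` t) (\<lambda>x. \<gamma> (h x))"
proof -
  have "isometry G t (\<gamma> ` t) \<gamma>"
    by (rule isometry_subset[OF deck_isometry[OF \<gamma>] convex_polyhedronD(1)[OF lift_polyhedron[OF h]]])
  then have "isometry G (body D s) (\<gamma> ` t) (\<lambda>x. \<gamma> (h x))"
    by (rule isometry_compose[OF lift_isometry[OF h]])
  then show ?thesis
    using isometry_convex_polyhedron[OF deck_isometry[OF \<gamma>] lift_polyhedron[OF h]]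
      proj_deck[OF \<gamma> lift_in[OF h]] lift_proj[OF h]
    by (simp add: lifts_def)
qed

lemma pairing:
  assumes "s \<in> cells D" and "f facet_of body D s"
  shows "nbr D s f \<in> cells D" and "glue D s f ` f facet_of body D (nbr D s f)"
    and "isometry G f (glue D s f ` f) (glue D s f)"
    and "(nbr D s f, glue D s f ` f) \<noteq> (s, f)" and "nbr D (nbr D s f) (glue D s f ` f) = s"
    and "\<And>x. x \<in> f \<Longrightarrow> glue D (nbr D s f) (glue D s f ` f) (glue D s f x) = x"
proof -
  have "face_pairing G D" using decomposes unfolding decomposes_def by (elim conjE)
  then have *: "nbr D s f \<in> cells D \<and> glue D s f ` f facet_of body D (nbr D s f) \<and>
      isometry G f (glue D s f ` f) (glue D s f) \<and> (nbr D s f, glue D s f ` f) \<noteq> (s, f) \<and>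
      nbr D (nbr D s f) (glue D s f ` f) = s \<and>
      (\<forall>x\<in>f. glue D (nbr D s f) (glue D s f ` f) (glue D s f x) = x)"
    unfolding face_pairing_def Let_def using assms by blast
  then show "nbr D s f \<in> cells D" and "glue D s f ` f facet_of body D (nbr D s f)"
    and "isometry G f (glue D s f ` f) (glue D s f)"
    and "(nbr D s f, glue D s f ` f) \<noteq> (s, f)" and "nbr D (nbr D s f) (glue D s f ` f) = s"
    and "\<And>x. x \<in> f \<Longrightarrow> glue D (nbr D s f) (glue D s f ` f) (glue D s f x) = x"
    by blast+
qed

lemma charmap_eq_iff:
  assumes "s \<in> cells D" "t \<in> cells D" "x \<in> body D s" "y \<in> body D t"
  shows "charmap D s x = charmap D t y \<longleftrightarrow> equivclp (glued D) (s, x) (t, y)"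
proof -
  have "\<forall>s\<in>cells D. \<forall>t\<in>cells D. \<forall>x\<in>body D s. \<forall>y\<in>body D t.
      charmap D s x = charmap D t y \<longleftrightarrow> equivclp (glued D) (s, x) (t, y)"
    using decomposes unfolding decomposes_def by (elim conjE)
  from this[rule_format, OF assms] show ?thesis .
qed

lemma charmap_glue:
  assumes s: "s \<in> cells D" and f: "f facet_of body D s" and x: "x \<in> f"
  shows "charmap D (nbr D s f) (glue D s f x) = charmap D s x"
proof -
  have "glued D (s, x) (nbr D s f, glue D s f x)" unfolding glued_def using assms by blast
  then have "equivclp (glued D) (s, x) (nbr D s f, glue D s f x)" by (rule r_into_equivclp)
  moreover have "x \<in> body D s" "glue D s f x \<in> body D (nbr D s f)"
    using x facet_of_imp_subset[OF f] facet_of_imp_subset[OF pairing(2)[OF s f]] by blast+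
  ultimately show ?thesis using charmap_eq_iff[OF s pairing(1)[OF s f]] by metis
qed

section \<open>Uniqueness of developments and neighbouring tiles\<close>

lemma facet_disjoint_interior:
  fixes p f :: "'b::euclidean_space set"
  assumes "f facet_of p"
  shows "f \<inter> interior p = {}"
  using assms face_of_disjoint_interior[of f p] facet_of_imp_face_of facet_of_irrefl by blast

lemma equivclp_glued_interior:
  assumes "equivclp (glued D) (s, x) v" and x: "x \<in> interior (body D s)"
  shows "v = (s, x)"
  using assms(1)
proof (induction rule: equivclp_induct)
  case base
  then show ?case by simp
next
  case (step y z)
  have "\<not> glued D (s, x) z" for z
    using x facet_disjoint_interior unfolding glued_def by blast
  moreover have "\<not> glued D z (s, x)" for z
  proof
    assume "glued D z (s, x)"
    then obtain s' f x' where g: "s' \<in> cells D" "f facet_of body D s'" "x' \<in> f"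
      "s = nbr D s' f" "x = glue D s' f x'" unfolding glued_def by blast
    then have "x \<in> glue D s' f ` f" "glue D s' f ` f facet_of body D s" using pairing(2) by auto
    then show False using x facet_disjoint_interior by blast
  qed
  ultimately show ?case using step by blast
qed

lemma lift_unique:
  assumes s: "s \<in> cells D" and h: "lifts G \<Gamma> D s t h"
    and s': "s' \<in> cells D" and h': "lifts G \<Gamma> D s' t' h'"
    and int: "interior t \<inter> interior t' \<noteq> {}"
  shows "s' = s" and "t' = t" and "\<And>x. x \<in> body D s \<Longrightarrow> h' x = h x"
proof -
  obtain z where z: "z \<in> interior t" "z \<in> interior t'" using int by blast
  have "h ` interior (body D s) = interior t"
    by (rule isometry_interior_image[OF lift_isometry[OF h] body_polyhedron[OF s]
          convex_polyhedronD(1)[OF lift_polyhedron[OF h]]])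
  then obtain x where x: "x \<in> interior (body D s)" "z = h x" using z(1) by blast
  have "h' ` interior (body D s') = interior t'"
    by (rule isometry_interior_image[OF lift_isometry[OF h'] body_polyhedron[OF s']
          convex_polyhedronD(1)[OF lift_polyhedron[OF h']]])
  then obtain x' where x': "x' \<in> interior (body D s')" "z = h' x'" using z(2) by blast
  have xb: "x \<in> body D s" "x' \<in> body D s'" using x x' interior_subset by blast+
  have "charmap D s x = charmap D s' x'"
    using lift_proj[OF h xb(1)] lift_proj[OF h' xb(2)] x(2) x'(2) by simp
  then have "(s', x') = (s, x)"
    using charmap_eq_iff[OF s s' xb] equivclp_glued_interior[OF _ x(1)] by blast
  then have xx: "x' = x" and ss: "s' = s" by auto
  from ss show "s' = s" .
  have h2: "lifts G \<Gamma> D s t' h'" using h' ss by simp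
  have bX: "h ` body D s \<subseteq> X" "h' ` body D s \<subseteq> X" using lift_in[OF h] lift_in[OF h2] by blast+
  obtain \<gamma> where \<gamma>: "\<gamma> \<in> \<Gamma>" "\<And>y. y \<in> body D s \<Longrightarrow> h' y = \<gamma> (h y)"
    using lifting_unique_up_to_deck[OF convex_connected[OF convex_polyhedronD(2)[OF body_polyhedron[OF s]]]
        _ lift_continuous[OF s h2] bX(2) lift_continuous[OF s h] bX(1)]
      lift_proj[OF h] lift_proj[OF h2] xb(1) by (metis empty_iff)
  have zX: "z \<in> X" using lift_in[OF h xb(1)] x(2) by simp
  \<comment> \<open>The two developments differ by \<open>\<gamma>\<close>, which fixes the common
    point \<open>z\<close>; the covering action is free, so they coincide.\<close>
  have "\<gamma> z = z" using \<gamma>(2)[OF xb(1)] x(2) x'(2) xx by simp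
  moreover obtain U where "z \<in> U" "\<And>\<gamma> y w. \<lbrakk>\<gamma> \<in> \<Gamma>; y \<in> U; \<gamma> y \<in> U; w \<in> X\<rbrakk> \<Longrightarrow> \<gamma> w = w"
    using deck_free_nbhd[OF zX] by metis
  ultimately have "\<gamma> w = w" if "w \<in> X" for w using \<gamma>(1) that by metis
  then show hh: "\<And>x. x \<in> body D s \<Longrightarrow> h' x = h x" using \<gamma>(2) lift_in[OF h] by simp
  show "t' = t" unfolding lift_image[OF h2] lift_image[OF h] using hh by (intro image_cong) auto
qed

text \<open>Start from any development \<open>k\<close> of the neighbour. On the connected facet,
  \<open>h\<close> and \<open>k\<close> after the gluing map lift the same map into the quotient, so
  a deck transformation moves \<open>k\<close> into place.\<close>

lemma neighbour_exists:
  assumes s: "s \<in> cells D" and h: "lifts G \<Gamma> D s t h" and f: "f facet_of body D s"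
  obtains t' k where "lifts G \<Gamma> D (nbr D s f) t' k" and "\<And>x. x \<in> f \<Longrightarrow> k (glue D s f x) = h x"
proof -
  note q = pairing(1)[OF s f]
  obtain t' k where k: "lifts G \<Gamma> D (nbr D s f) t' k" using lift_exists[OF q] .
  let ?\<phi> = "glue D s f"
  have fb: "f \<subseteq> body D s" "?\<phi> ` f \<subseteq> body D (nbr D s f)"
    using facet_of_imp_subset f pairing(2)[OF s f] by blast+
  have "continuous_on f ?\<phi>"
    by (rule isometry_continuous_on[OF pairing(3)[OF s f]]) (use fb body_subset s q in blast)+
  then have "continuous_on f (\<lambda>x. k (?\<phi> x))"
    by (rule continuous_on_compose2[OF lift_continuous[OF q k] _ fb(2)])
  moreover have "continuous_on f h" by (rule continuous_on_subset[OF lift_continuous[OF s h] fb(1)])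
  moreover have "connected f" "f \<noteq> {}"
    using f by (auto simp: facet_of_def face_of_def intro: convex_connected)
  moreover have "h ` f \<subseteq> X" "(\<lambda>x. k (?\<phi> x)) ` f \<subseteq> X" using fb lift_in[OF h] lift_in[OF k] by blast+
  moreover have "proj \<Gamma> (h x) = proj \<Gamma> (k (?\<phi> x))" if "x \<in> f" for x
  proof -
    have "x \<in> body D s" "?\<phi> x \<in> body D (nbr D s f)" using that fb by blast+
    then show ?thesis using charmap_glue[OF s f that] lift_proj[OF h] lift_proj[OF k] by simp
  qed
  ultimately obtain \<gamma> where \<gamma>: "\<gamma> \<in> \<Gamma>" "\<And>x. x \<in> f \<Longrightarrow> h x = \<gamma> (k (?\<phi> x))"
    using lifting_unique_up_to_deck[of f h "\<lambda>x. k (?\<phi> x)"] by metis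
  then show ?thesis using that[OF lift_deck[OF q k \<gamma>(1)]] by simp
qed

lemma lift_facet:
  assumes s: "s \<in> cells D" and h: "lifts G \<Gamma> D s t h" and f: "f facet_of body D s"
  shows "h ` f facet_of t"
  by (rule isometry_facet_image[OF lift_isometry[OF h] body_polyhedron[OF s]
        convex_polyhedronD(1)[OF lift_polyhedron[OF h]] f])

lemma neighbour_facet:
  assumes s: "s \<in> cells D" and f: "f facet_of body D s"
    and k: "lifts G \<Gamma> D (nbr D s f) t' k" and kh: "\<And>x. x \<in> f \<Longrightarrow> k (glue D s f x) = h x"
  shows "h ` f facet_of t'"
proof -
  have "k ` glue D s f ` f = h ` f" unfolding image_image using kh by (intro image_cong) auto
  then show ?thesis using lift_facet[OF pairing(1)[OF s f] k pairing(2)[OF s f]] by simp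
qed

text \<open>An overlap would make the two developments equal, so the gluing map would fix
  \<open>f\<close> pointwise and pair \<open>(s, f)\<close> with itself, which
  \<open>face_pairing\<close> excludes.\<close>

lemma neighbour_disjoint:
  assumes s: "s \<in> cells D" and h: "lifts G \<Gamma> D s t h" and f: "f facet_of body D s"
    and k: "lifts G \<Gamma> D (nbr D s f) t' k" and kh: "\<And>x. x \<in> f \<Longrightarrow> k (glue D s f x) = h x"
  shows "interior t \<inter> interior t' = {}"
proof (rule ccontr)
  assume int: "interior t \<inter> interior t' \<noteq> {}"
  note q = pairing(1)[OF s f]
  note u = lift_unique[OF s h q k int]
  have fb: "f \<subseteq> body D s" "glue D s f ` f \<subseteq> body D s"
    using facet_of_imp_subset f pairing(2)[OF s f] u(1) by auto
  have "glue D s f x = x" if x: "x \<in> f" for x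
  proof -
    have xb: "glue D s f x \<in> body D s" "x \<in> body D s" using x fb by blast+
    have "h (glue D s f x) = h x" using kh[OF x] u(3)[OF xb(1)] by simp
    then show ?thesis
      using isometry_inj_on[OF lift_isometry[OF h] body_subset[OF s]] xb by (auto dest: inj_onD)
  qed
  then have "glue D s f ` f = f" by simp
  then show False using pairing(4)[OF s f] u(1) by simp
qed

section \<open>The tiling and its connectedness through facets\<close>

lemma tiling_iff: "t \<in> tiling G \<Gamma> D \<longleftrightarrow> (\<exists>s\<in>cells D. \<exists>h. lifts G \<Gamma> D s t h)"
  by (simp add: tiling_def)

lemma tile_polyhedron: "t \<in> tiling G \<Gamma> D \<Longrightarrow> convex_polyhedron G t"
  using lift_polyhedron by (auto simp: tiling_iff)

lemma tile_unique:
  "\<lbrakk>t \<in> tiling G \<Gamma> D; t' \<in> tiling G \<Gamma> D; interior t \<inter> interior t' \<noteq> {}\<rbrakk> \<Longrightarrow> t' = t"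
  using lift_unique(2) unfolding tiling_iff by blast

lemma tiling_covers:
  assumes x: "x \<in> X"
  obtains t where "t \<in> tiling G \<Gamma> D" and "x \<in> t"
proof -
  have "proj \<Gamma> x \<in> quotient_manifold G \<Gamma>" using x by (simp add: quotient_manifold_def)
  then have "proj \<Gamma> x \<in> (\<Union>s\<in>cells D. charmap D s ` body D s)"
    using decomposes unfolding decomposes_def by (elim conjE) (simp only:)
  then obtain s y where s: "s \<in> cells D" and y: "y \<in> body D s" and "proj \<Gamma> x = charmap D s y" by blast
  moreover obtain t h where h: "lifts G \<Gamma> D s t h" using lift_exists[OF s] .
  ultimately obtain \<gamma> where \<gamma>: "\<gamma> \<in> \<Gamma>" "x = \<gamma> (h y)" using lift_proj[OF h y] proj_eqD[OF _ x] by metis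
  have "x \<in> \<gamma> ` t" using \<gamma>(2) y lift_image[OF h] by blast
  moreover have "\<gamma> ` t \<in> tiling G \<Gamma> D" using lift_deck[OF s h \<gamma>(1)] s by (auto simp: tiling_iff)
  ultimately show ?thesis using that by blast
qed

text \<open>Disjoint nonempty open interiors in a separable space are countable in number, which is
  what \<open>generic_segment\<close> asks of the union of the skeleta.\<close>

lemma countable_tiling: "countable (tiling G \<Gamma> D)"
proof (rule countable_image_inj_on)
  have ne: "interior t \<noteq> {}" if "t \<in> tiling G \<Gamma> D" for t
    using convex_polyhedronD(3)[OF tile_polyhedron[OF that]] .
  show "inj_on interior (tiling G \<Gamma> D)"
    by (rule inj_onI) (use tile_unique ne in fastforce)
  show "countable (interior ` tiling G \<Gamma> D)"
  proof (rule countable_disjoint_open_subsets)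
    show "disjoint (interior ` tiling G \<Gamma> D)"
      using tile_unique unfolding pairwise_def disjnt_def by blast
  qed auto
qed

text \<open>The tiling need not be known to be locally finite: a segment joining generic points of two
  tiles avoids the countably many faces of codimension at least 2, and every other point of \<open>X\<close>
  has a neighbourhood covered by at most two tiles sharing a facet.\<close>

lemma tile_induct:
  assumes base: "t0 \<in> tiling G \<Gamma> D" "P t0"
    and step: "\<And>s t h f t' k. \<lbrakk>s \<in> cells D; lifts G \<Gamma> D s t h; P t; f facet_of body D s;
      lifts G \<Gamma> D (nbr D s f) t' k; \<And>x. x \<in> f \<Longrightarrow> k (glue D s f x) = h x\<rbrakk> \<Longrightarrow> P t'"
    and t1: "t1 \<in> tiling G \<Gamma> D"
  shows "P t1"
proof (rule ccontr)
  assume nP: "\<not> P t1"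
  let ?T = "tiling G \<Gamma> D"
  \<comment> \<open>Gluings come in inverse pairs, so crossing the facet back is again an instance
    of \<open>step\<close>.\<close>
  have step_iff: "P t' \<longleftrightarrow> P t"
    if s: "s \<in> cells D" and h: "lifts G \<Gamma> D s t h" and f: "f facet_of body D s"
      and k: "lifts G \<Gamma> D (nbr D s f) t' k" and kh: "\<And>x. x \<in> f \<Longrightarrow> k (glue D s f x) = h x"
    for s t h f t' k
  proof
    assume "P t'"
    let ?q = "nbr D s f" and ?f' = "glue D s f ` f"
    have "lifts G \<Gamma> D (nbr D ?q ?f') t h" using h pairing(5)[OF s f] by simp
    moreover have "h (glue D ?q ?f' y) = k y" if "y \<in> ?f'" for y
      using that kh pairing(6)[OF s f] by auto
    ultimately show "P t" using step[OF pairing(1)[OF s f] k \<open>P t'\<close> pairing(2)[OF s f]] by blast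
  qed (rule step[OF s h _ f k kh])
  define skel where "skel t \<E> \<longleftrightarrow> finite \<E> \<and> (\<forall>E\<in>\<E>. aff_dim E = int DIM('a) - 2) \<and>
      (\<forall>z\<in>t. z \<notin> \<Union>\<E> \<longrightarrow> z \<notin> interior t \<longrightarrow> (\<exists>f. f facet_of t \<and> z \<in> rel_interior f))"
    for t :: "'a set" and \<E>
  have "\<exists>\<E>. skel t \<E>" if "t \<in> ?T" for t
  proof (rule polyhedron_skeleton[OF tile_polyhedron[OF that]])
    fix \<E> :: "'a set set"
    assume "finite \<E>" "\<And>E. E \<in> \<E> \<Longrightarrow> aff_dim E = int DIM('a) - 2"
      "\<And>z. \<lbrakk>z \<in> t; z \<notin> \<Union>\<E>; z \<notin> interior t\<rbrakk> \<Longrightarrow> \<exists>f. f facet_of t \<and> z \<in> rel_interior f"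
    then show ?thesis unfolding skel_def by (intro exI[of _ \<E>]) simp
  qed
  then obtain sk where "\<And>t. t \<in> ?T \<Longrightarrow> skel t (sk t)" by metis
  then have sk: "\<And>t. t \<in> ?T \<Longrightarrow> finite (sk t)"
    "\<And>t E. \<lbrakk>t \<in> ?T; E \<in> sk t\<rbrakk> \<Longrightarrow> aff_dim E = int DIM('a) - 2"
    "\<And>t z. \<lbrakk>t \<in> ?T; z \<in> t; z \<notin> \<Union>(sk t); z \<notin> interior t\<rbrakk> \<Longrightarrow> \<exists>f. f facet_of t \<and> z \<in> rel_interior f"
    unfolding skel_def by blast+
  define \<E> where "\<E> = (\<Union>t\<in>?T. sk t)"
  have "countable \<E>" unfolding \<E>_def using countable_tiling sk(1) by (blast intro: countable_finite)
  moreover have "aff_dim E \<le> int DIM('a) - 2" if "E \<in> \<E>" for E using that sk(2) by (auto simp: \<E>_def)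
  ultimately obtain a b where ab: "a \<in> interior t0" "b \<in> interior t1" "closed_segment a b \<inter> \<Union>\<E> = {}"
    using generic_segment[of \<E> "interior t0" "interior t1"]
      convex_polyhedronD(3)[OF tile_polyhedron[OF base(1)]] convex_polyhedronD(3)[OF tile_polyhedron[OF t1]]
    by (metis open_interior)
  \<comment> \<open>Pairs of tiles are needed because a relative interior point of a facet is
    interior only to the union of the two adjacent tiles; \<open>t' = t\<close> covers the interior
    points. For \<open>P\<close> and its negation these open sets will disconnect the
    segment.\<close>
  define O1 where "O1 Q = (\<Union>t\<in>{t\<in>?T. Q t}. \<Union>t'\<in>{t\<in>?T. Q t}. interior (t \<union> t'))" for Q :: "'a set \<Rightarrow> bool"
  have openO: "open (O1 Q)" for Q by (auto simp: O1_def)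
  have X: "closed_segment a b \<subseteq> X"
    using ab(1,2) convex_polyhedronD(1)[OF tile_polyhedron[OF base(1)]]
      convex_polyhedronD(1)[OF tile_polyhedron[OF t1]] interior_subset
    by (intro closed_segment_subset convex_model_space) blast+
  have cover: "closed_segment a b \<subseteq> O1 P \<union> O1 (\<lambda>t. \<not> P t)"
  proof
    fix z assume z: "z \<in> closed_segment a b"
    then obtain t where t: "t \<in> ?T" "z \<in> t" using tiling_covers X by blast
    show "z \<in> O1 P \<union> O1 (\<lambda>t. \<not> P t)"
    proof (cases "z \<in> interior t")
      case True
      then have "z \<in> interior (t \<union> t)" by simp
      then show ?thesis using t(1) unfolding O1_def by blast
    next
      case False
      have "z \<notin> \<Union>(sk t)" using z ab(3) t(1) by (auto simp: \<E>_def)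
      then obtain f where f: "f facet_of t" "z \<in> rel_interior f" using sk(3)[OF t _ False] by blast
      obtain s h where s: "s \<in> cells D" and h: "lifts G \<Gamma> D s t h" using t(1) by (auto simp: tiling_iff)
      define f0 where "f0 = inv_into (body D s) h ` f"
      have f0: "f0 facet_of body D s" unfolding f0_def
        by (rule isometry_facet_image[OF isometry_inv_into[OF lift_isometry[OF h] body_subset[OF s]]
              lift_polyhedron[OF h] body_subset[OF s] f(1)])
      have "f \<subseteq> h ` body D s" using facet_of_imp_subset[OF f(1)] lift_image[OF h] by simp
      then have hf0: "h ` f0 = f" unfolding f0_def by (rule image_inv_into_cancel[OF refl])
      obtain t' k where k: "lifts G \<Gamma> D (nbr D s f0) t' k" "\<And>x. x \<in> f0 \<Longrightarrow> k (glue D s f0 x) = h x"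
        using neighbour_exists[OF s h f0] by blast
      have t': "t' \<in> ?T" using k(1) pairing(1)[OF s f0] by (auto simp: tiling_iff)
      have "z \<in> interior (t \<union> t')"
        by (rule facet_union_neighbourhood[OF convex_polyhedronD(2,3)[OF tile_polyhedron[OF t(1)]] f(1)
              convex_polyhedronD(2,3)[OF tile_polyhedron[OF t']]
              neighbour_facet[OF s f0 k(1), of h, OF k(2), unfolded hf0]
              neighbour_disjoint[OF s h f0 k] f(2)])
      then show ?thesis using t(1) t' step_iff[OF s h f0 k] unfolding O1_def by blast
    qed
  qed
  have disj: "O1 P \<inter> O1 (\<lambda>t. \<not> P t) = {}"
  proof (rule ccontr)
    \<comment> \<open>Each tile lies in the closure of its interior, so a nonempty open set covered
      by two tiles meets the interior of one of them. Applied twice, this gives two tiles with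
      overlapping interiors but opposite values of \<open>P\<close>.\<close>
    have shrink: "\<exists>t\<in>{t1, t2}. W \<inter> interior t \<noteq> {}"
      if W: "open W" "W \<noteq> {}" "W \<subseteq> t1 \<union> t2" and "t1 \<in> ?T" "t2 \<in> ?T" for W t1 t2
    proof -
      obtain w t where w: "w \<in> W" "t \<in> {t1, t2}" "w \<in> t" using W by blast
      then have t: "convex t" "interior t \<noteq> {}"
        using that convex_polyhedronD(2,3)[OF tile_polyhedron] by auto
      have "w \<in> closure (interior t)"
        using w(3) closure_subset convex_closure_interior[OF t] by blast
      then show ?thesis using w(1,2) W(1) open_Int_closure_eq_empty[of W "interior t"] by blast
    qed
    assume "O1 P \<inter> O1 (\<lambda>t. \<not> P t) \<noteq> {}"
    then obtain z p p' n n' where p: "p \<in> ?T" "p' \<in> ?T" "P p" "P p'" "z \<in> interior (p \<union> p')"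
      and n: "n \<in> ?T" "n' \<in> ?T" "\<not> P n" "\<not> P n'" "z \<in> interior (n \<union> n')"
      unfolding O1_def by blast
    define W where "W = interior (p \<union> p') \<inter> interior (n \<union> n')"
    have W: "open W" "W \<noteq> {}" "W \<subseteq> p \<union> p'" "W \<subseteq> n \<union> n'"
      using p(5) n(5) interior_subset by (auto simp: W_def)
    obtain t where t: "t \<in> {p, p'}" "W \<inter> interior t \<noteq> {}" using shrink[OF W(1-3) p(1,2)] by blast
    have "open (W \<inter> interior t)" "W \<inter> interior t \<subseteq> n \<union> n'" using W by auto
    then obtain t' where t': "t' \<in> {n, n'}" "W \<inter> interior t \<inter> interior t' \<noteq> {}"
      using shrink[OF _ t(2) _ n(1,2)] by blast
    then have "interior t \<inter> interior t' \<noteq> {}" by blast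
    then have "t' = t" using tile_unique t(1) t'(1) p(1,2) n(1,2) by blast
    then show False using t(1) t'(1) p(3,4) n(3,4) by blast
  qed
  have "a \<in> interior (t0 \<union> t0)" "b \<in> interior (t1 \<union> t1)" using ab(1,2) by simp_all
  then have "a \<in> O1 P" "b \<in> O1 (\<lambda>t. \<not> P t)"
    unfolding O1_def using base t1 nP by blast+
  then show False
    using connectedD[OF connected_segment(1)[of a b] openO[of P] openO[of "\<lambda>t. \<not> P t"]] cover disj
    by (metis Int_assoc Int_empty_left Int_commute disjoint_iff ends_in_segment(1,2))
qed

end

section \<open>Comparing two tilings\<close>

locale tiled_pair =
  M: tiled_manifold G \<Gamma> D + M': tiled_manifold G \<Gamma>' D'
  for G :: geometry and \<Gamma> \<Gamma>' :: "('a::euclidean_space \<Rightarrow> 'a) set"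
    and D :: "('a, 's) decomposition" and D' :: "('a, 't) decomposition"
begin

text \<open>\<open>j\<close> is \<open>g\<close> read in the developments: first \<open>h\<close>,
  then \<open>g\<close>, then the inverse of \<open>h'\<close>. It is restricted to the body because
  \<open>Theta\<close> requires extensional maps.\<close>

lemma matching_isometry:
  assumes g: "isometry G (model_space G) (model_space G) g"
    and p: "p \<in> cells D" "lifts G \<Gamma> D p t h" and p': "p' \<in> cells D'" "lifts G \<Gamma>' D' p' (g ` t) h'"
  obtains j where "(j, p, p') \<in> Theta G D D'" and "\<And>x. x \<in> body D p \<Longrightarrow> h' (j x) = g (h x)"
proof -
  define i where "i x = inv_into (body D' p') h' (g (h x))" for x
  have tX: "t \<subseteq> model_space G" using convex_polyhedronD(1)[OF M.lift_polyhedron[OF p(2)]] .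
  have gh: "isometry G (body D p) (g ` t) (\<lambda>x. g (h x))"
    by (rule isometry_compose[OF M.lift_isometry[OF p(2)] isometry_subset[OF g tX]])
  then have "isometry G (body D p) (body D' p') i"
    unfolding i_def
    by (rule isometry_compose[OF _ isometry_inv_into[OF M'.lift_isometry[OF p'(2)] M'.body_subset[OF p'(1)]]])
  then have "isometry G (body D p) (body D' p') (restrict i (body D p))"
    by (rule isometry_cong) simp
  then have "(restrict i (body D p), p, p') \<in> Theta G D D'"
    using p(1) p'(1) by (simp add: Theta_def)
  moreover have "h' (restrict i (body D p) x) = g (h x)" if x: "x \<in> body D p" for x
  proof -
    have "g (h x) \<in> h' ` body D' p'"
      using x M.lift_image[OF p(2)] M'.lift_image[OF p'(2)] by blast
    then show ?thesis using x by (simp add: i_def f_inv_into_f)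
  qed
  ultimately show ?thesis using that by blast
qed

text \<open>The configuration common to both implications: \<open>t'\<close> is the image of
  \<open>t\<close>, and across the same facet of \<open>t'\<close> lie both the image of the
  neighbour \<open>u\<close> and the neighbour \<open>u'\<close> in the second tiling. The
  conclusions are the hypotheses of \<open>same_side_overlap\<close> and of
  \<open>isometries_agree_across_facet\<close>.\<close>

lemma matched_neighbours:
  assumes g: "isometry G (model_space G) (model_space G) g"
    and s: "s \<in> cells D" and h: "lifts G \<Gamma> D s t h"
    and s': "s' \<in> cells D'" and h': "lifts G \<Gamma>' D' s' t' h'"
    and j: "isometry G (body D s) (body D' s') j"
    and ghj: "\<And>x. x \<in> body D s \<Longrightarrow> g (h x) = h' (j x)"
    and f: "f facet_of body D s"
    and k: "lifts G \<Gamma> D (nbr D s f) u k" "\<And>x. x \<in> f \<Longrightarrow> k (glue D s f x) = h x"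
    and k': "lifts G \<Gamma>' D' (nbr D' s' (j ` f)) u' k'"
      "\<And>y. y \<in> j ` f \<Longrightarrow> k' (glue D' s' (j ` f) y) = h' y"
  shows "convex_polyhedron G (g ` u)" and "g ` h ` f facet_of t'" and "g ` h ` f facet_of g ` u"
    and "g ` h ` f facet_of u'" and "interior t' \<inter> interior (g ` u) = {}"
    and "interior t' \<inter> interior u' = {}"
proof -
  have jf: "j ` f facet_of body D' s'"
    by (rule isometry_facet_image[OF j M.body_polyhedron[OF s] M'.body_subset[OF s'] f])
  have fb: "f \<subseteq> body D s" by (rule facet_of_imp_subset[OF f])
  have ghf: "g ` h ` f = h' ` j ` f"
    unfolding image_image using ghj fb by (intro image_cong) auto
  have "g ` h ` body D s = h' ` j ` body D s"
    unfolding image_image using ghj by (intro image_cong) auto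
  then have gt: "g ` t = t'"
    using M.lift_image[OF h] M'.lift_image[OF h'] j by (simp add: isometry_def)
  note tX = convex_polyhedronD(1)[OF M.lift_polyhedron[OF h]]
  note uX = convex_polyhedronD(1)[OF M.lift_polyhedron[OF k(1)]]
  show gu: "convex_polyhedron G (g ` u)"
    by (rule isometry_convex_polyhedron[OF g M.lift_polyhedron[OF k(1)]])
  show "g ` h ` f facet_of t'" unfolding ghf by (rule M'.lift_facet[OF s' h' jf])
  show "g ` h ` f facet_of g ` u"
    by (rule isometry_facet_image[OF isometry_subset[OF g uX] M.lift_polyhedron[OF k(1)]
          convex_polyhedronD(1)[OF gu] M.neighbour_facet[OF s f k]])
  show "g ` h ` f facet_of u'" unfolding ghf by (rule M'.neighbour_facet[OF s' jf k'])
  show "interior t' \<inter> interior u' = {}" by (rule M'.neighbour_disjoint[OF s' h' jf k'])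
  have "g ` interior t = interior t'"
    by (rule isometry_interior_image[OF isometry_subset[OF g tX, unfolded gt] M.lift_polyhedron[OF h]
          convex_polyhedronD(1)[OF M'.lift_polyhedron[OF h']]])
  moreover have "g ` interior u = interior (g ` u)"
    by (rule isometry_interior_image[OF isometry_subset[OF g uX] M.lift_polyhedron[OF k(1)]
          convex_polyhedronD(1)[OF gu]])
  moreover have "g ` interior t \<inter> g ` interior u = {}"
  proof -
    have "interior t \<subseteq> model_space G" "interior u \<subseteq> model_space G"
      using tX uX interior_subset by blast+
    then have "g ` (interior t \<inter> interior u) = g ` interior t \<inter> g ` interior u"
      using inj_on_image_Int[OF isometry_inj_on[OF g order_refl]] by blast
    then show ?thesis using M.neighbour_disjoint[OF s h f k] by simp
  qed
  ultimately show "interior t' \<inter> interior (g ` u) = {}" by simp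
qed

lemma extendable_of_isometric:
  assumes "isometric_tilings G (tiling G \<Gamma> D) (tiling G \<Gamma>' D')"
  obtains I where "I \<noteq> {}" and "I \<subseteq> Theta G D D'"
    and "\<And>j p p' f. \<lbrakk>(j, p, p') \<in> I; f facet_of body D p\<rbrakk> \<Longrightarrow> \<exists>\<tau>\<in>I. extends_across D D' (j, p, p') f \<tau>"
proof -
  obtain g where g: "isometry G (model_space G) (model_space G) g"
    and gT: "(\<lambda>t. g ` t) ` tiling G \<Gamma> D = tiling G \<Gamma>' D'"
    using assms by (auto simp: isometric_tilings_def)
  have g_tile: "\<exists>p'\<in>cells D'. \<exists>h'. lifts G \<Gamma>' D' p' (g ` t) h'"
    if "p \<in> cells D" "lifts G \<Gamma> D p t h" for p t h
  proof -
    have "g ` t \<in> tiling G \<Gamma>' D'" unfolding gT[symmetric] using that M.tiling_iff by blast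
    then show ?thesis by (simp add: M'.tiling_iff)
  qed
  define matched where "matched j p p' \<longleftrightarrow> (\<exists>t h h'. lifts G \<Gamma> D p t h \<and>
      lifts G \<Gamma>' D' p' (g ` t) h' \<and> (\<forall>x\<in>body D p. h' (j x) = g (h x)))" for j p p'
  define I where "I = {(j, p, p'). (j, p, p') \<in> Theta G D D' \<and> matched j p p'}"
  have "I \<noteq> {}"
  proof -
    obtain t where "t \<in> tiling G \<Gamma> D" using M.tiling_covers[OF zero_in_model_space] by blast
    then obtain p h where p: "p \<in> cells D" "lifts G \<Gamma> D p t h" using M.tiling_iff by blast
    obtain p' h' where p': "p' \<in> cells D'" "lifts G \<Gamma>' D' p' (g ` t) h'" using g_tile[OF p] by blast
    obtain j where "(j, p, p') \<in> Theta G D D'" "\<And>x. x \<in> body D p \<Longrightarrow> h' (j x) = g (h x)"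
      using matching_isometry[OF g p p'] by blast
    then have "(j, p, p') \<in> I" using p p' unfolding I_def matched_def by blast
    then show ?thesis by blast
  qed
  moreover have "I \<subseteq> Theta G D D'" by (auto simp: I_def)
  moreover have "\<exists>\<tau>\<in>I. extends_across D D' (j, p, p') f \<tau>"
    if jI: "(j, p, p') \<in> I" and f: "f facet_of body D p" for j p p' f
  proof -
    have \<Theta>: "(j, p, p') \<in> Theta G D D'" and "matched j p p'" using jI by (auto simp: I_def)
    then obtain t h h' where h: "lifts G \<Gamma> D p t h" and h': "lifts G \<Gamma>' D' p' (g ` t) h'"
      and ghj: "\<And>x. x \<in> body D p \<Longrightarrow> h' (j x) = g (h x)" unfolding matched_def by blast
    have p: "p \<in> cells D" and p': "p' \<in> cells D'" and j: "isometry G (body D p) (body D' p') j"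
      using \<Theta> by (auto simp: Theta_def)
    have jf: "j ` f facet_of body D' p'"
      by (rule isometry_facet_image[OF j M.body_polyhedron[OF p] M'.body_subset[OF p'] f])
    note q = M.pairing(1)[OF p f] and q' = M'.pairing(1)[OF p' jf]
    obtain u k where k: "lifts G \<Gamma> D (nbr D p f) u k" "\<And>x. x \<in> f \<Longrightarrow> k (glue D p f x) = h x"
      using M.neighbour_exists[OF p h f] by blast
    obtain u' k' where k': "lifts G \<Gamma>' D' (nbr D' p' (j ` f)) u' k'"
      "\<And>y. y \<in> j ` f \<Longrightarrow> k' (glue D' p' (j ` f) y) = h' y"
      using M'.neighbour_exists[OF p' h' jf] by blast
    note nb = matched_neighbours[OF g p h p' h' j ghj[symmetric] f k k']
    have "interior u' \<inter> interior (g ` u) \<noteq> {}"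
      by (rule same_side_overlap[OF convex_polyhedronD(2,3)[OF M'.lift_polyhedron[OF h']] nb(2)
            convex_polyhedronD(2,3)[OF M'.lift_polyhedron[OF k'(1)]] nb(4)
            convex_polyhedronD(2,3)[OF nb(1)] nb(3,6,5)])
    moreover have "g ` u \<in> tiling G \<Gamma>' D'" using g_tile[OF q k(1)] by (simp add: M'.tiling_iff)
    moreover have "u' \<in> tiling G \<Gamma>' D'" using k'(1) q' M'.tiling_iff by blast
    ultimately have "g ` u = u'" using M'.tile_unique by blast
    then have k'u: "lifts G \<Gamma>' D' (nbr D' p' (j ` f)) (g ` u) k'" using k'(1) by simp
    obtain l where l: "(l, nbr D p f, nbr D' p' (j ` f)) \<in> Theta G D D'"
      "\<And>x. x \<in> body D (nbr D p f) \<Longrightarrow> k' (l x) = g (k x)"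
      using matching_isometry[OF g q k(1) q' k'u] by blast
    \<comment> \<open>Both sides lie in one body, on which the development \<open>k'\<close> is
      injective, so it suffices to compare their images in \<open>X\<close>.\<close>
    have "l (glue D p f x) = glue D' p' (j ` f) (j x)" if x: "x \<in> f" for x
    proof -
      have xb: "x \<in> body D p" "glue D p f x \<in> body D (nbr D p f)"
        using x facet_of_imp_subset[OF f] facet_of_imp_subset[OF M.pairing(2)[OF p f]] by blast+
      have "k' (l (glue D p f x)) = g (h x)" using l(2)[OF xb(2)] k(2)[OF x] by simp
      also have "\<dots> = k' (glue D' p' (j ` f) (j x))" using k'(2)[of "j x"] x ghj[OF xb(1)] by simp
      finally have "k' (l (glue D p f x)) = k' (glue D' p' (j ` f) (j x))" .
      moreover have "l (glue D p f x) \<in> body D' (nbr D' p' (j ` f))"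
        using l(1) xb(2) by (auto simp: Theta_def isometry_def)
      moreover have "glue D' p' (j ` f) (j x) \<in> body D' (nbr D' p' (j ` f))"
        using x facet_of_imp_subset[OF M'.pairing(2)[OF p' jf]] by blast
      ultimately show ?thesis
        using inj_onD[OF isometry_inj_on[OF M'.lift_isometry[OF k'(1)] M'.body_subset[OF q']]] by blast
    qed
    then have "extends_across D D' (j, p, p') f (l, nbr D p f, nbr D' p' (j ` f))"
      by (simp add: extends_across_def)
    moreover have "(l, nbr D p f, nbr D' p' (j ` f)) \<in> I"
      using l k(1) k'u unfolding I_def matched_def by blast
    ultimately show ?thesis by blast
  qed
  ultimately show ?thesis using that by blast
qed

lemma isometric_of_extendable:
  assumes I: "I \<noteq> {}" "I \<subseteq> Theta G D D'"
    and ext: "\<And>j p p' f. \<lbrakk>(j, p, p') \<in> I; f facet_of body D p\<rbrakk> \<Longrightarrow> \<exists>\<tau>\<in>I. extends_across D D' (j, p, p') f \<tau>"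
  shows "isometric_tilings G (tiling G \<Gamma> D) (tiling G \<Gamma>' D')"
proof -
  have \<Theta>: "p \<in> cells D" "p' \<in> cells D'" "isometry G (body D p) (body D' p') j" if "(j, p, p') \<in> I" for j p p'
    using that I(2) by (auto simp: Theta_def)
  obtain j0 p0 p0' where j0: "(j0, p0, p0') \<in> I" using I(1) by auto
  obtain t0 h0 where h0: "lifts G \<Gamma> D p0 t0 h0" using M.lift_exists[OF \<Theta>(1)[OF j0]] by blast
  obtain t0' h0' where h0': "lifts G \<Gamma>' D' p0' t0' h0'" using M'.lift_exists[OF \<Theta>(2)[OF j0]] by blast
  note t0 = convex_polyhedronD[OF M.lift_polyhedron[OF h0]]
  \<comment> \<open>The candidate for \<open>g\<close> on the single tile \<open>t0\<close>: undo
    \<open>h0\<close>, apply \<open>j0\<close>, and develop by \<open>h0'\<close>. It is then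
    extended to all of \<open>X\<close>.\<close>
  have "isometry G t0 (body D' p0') (\<lambda>y. j0 (inv_into (body D p0) h0 y))"
    by (rule isometry_compose[OF isometry_inv_into[OF M.lift_isometry[OF h0]
          M.body_subset[OF \<Theta>(1)[OF j0]]] \<Theta>(3)[OF j0]])
  note iso = isometry_compose[OF this M'.lift_isometry[OF h0']]
  obtain g where g: "motion G g"
    "\<And>y. y \<in> t0 \<Longrightarrow> g y = h0' (j0 (inv_into (body D p0) h0 y))"
    using isometry_extends[OF iso t0(1) convex_polyhedronD(1)[OF M'.lift_polyhedron[OF h0']] t0(3)]
    by blast
  note giso = motion_isometry[OF g(1)]
  define P where "P t \<longleftrightarrow> (\<exists>j p p' h t' h'. (j, p, p') \<in> I \<and> lifts G \<Gamma> D p t h \<and>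
      lifts G \<Gamma>' D' p' t' h' \<and> (\<forall>x\<in>body D p. g (h x) = h' (j x)))" for t
  have "P t0"
  proof -
    have "g (h0 x) = h0' (j0 x)" if x: "x \<in> body D p0" for x
      using g(2)[of "h0 x"] x M.lift_image[OF h0]
        isometry_inj_on[OF M.lift_isometry[OF h0] M.body_subset[OF \<Theta>(1)[OF j0]]] by simp
    then show ?thesis unfolding P_def using j0 h0 h0' by blast
  qed
  have step: "P u" if s: "s \<in> cells D" and h: "lifts G \<Gamma> D s t h" and "P t" and f: "f facet_of body D s"
      and k: "lifts G \<Gamma> D (nbr D s f) u k" "\<And>x. x \<in> f \<Longrightarrow> k (glue D s f x) = h x"
    for s t h f u k
  proof -
    obtain j p s' h1 t' h' where j: "(j, p, s') \<in> I" and h1: "lifts G \<Gamma> D p t h1"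
      and h': "lifts G \<Gamma>' D' s' t' h'" and gh1: "\<And>x. x \<in> body D p \<Longrightarrow> g (h1 x) = h' (j x)"
      using \<open>P t\<close> unfolding P_def by blast
    \<comment> \<open>\<open>P t\<close> provides some development of the tile \<open>t\<close>; as
      \<open>t\<close> overlaps itself, \<open>lift_unique\<close> identifies it with the given
      \<open>s\<close> and \<open>h\<close>.\<close>
    have "interior t \<inter> interior t \<noteq> {}" using convex_polyhedronD(3)[OF M.lift_polyhedron[OF h]] by simp
    note lu = M.lift_unique[OF s h \<Theta>(1)[OF j] h1 this]
    have js: "(j, s, s') \<in> I" and gh: "\<And>x. x \<in> body D s \<Longrightarrow> g (h x) = h' (j x)"
      using j gh1 lu(1,3) by auto
    note s' = \<Theta>(2)[OF js] and jiso = \<Theta>(3)[OF js]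
    have jf: "j ` f facet_of body D' s'"
      by (rule isometry_facet_image[OF jiso M.body_polyhedron[OF s] M'.body_subset[OF s'] f])
    note q = M.pairing(1)[OF s f] and q' = M'.pairing(1)[OF s' jf]
    obtain l where l: "(l, nbr D s f, nbr D' s' (j ` f)) \<in> I"
      "\<And>x. x \<in> f \<Longrightarrow> l (glue D s f x) = glue D' s' (j ` f) (j x)"
      using ext[OF js f] by (auto simp: extends_across_def)
    obtain u' k' where k': "lifts G \<Gamma>' D' (nbr D' s' (j ` f)) u' k'"
      "\<And>y. y \<in> j ` f \<Longrightarrow> k' (glue D' s' (j ` f) y) = h' y"
      using M'.neighbour_exists[OF s' h' jf] by blast
    note nb = matched_neighbours[OF giso s h s' h' jiso gh f k k']
    have fb: "f \<subseteq> body D s" by (rule facet_of_imp_subset[OF f])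
    have gk: "isometry G (body D (nbr D s f)) (g ` u) (\<lambda>y. g (k y))"
      by (rule isometry_compose[OF M.lift_isometry[OF k(1)]
            isometry_subset[OF giso convex_polyhedronD(1)[OF M.lift_polyhedron[OF k(1)]]]])
    have k'l: "isometry G (body D (nbr D s f)) u' (\<lambda>y. k' (l y))"
      by (rule isometry_compose[OF \<Theta>(3)[OF l(1)] M'.lift_isometry[OF k'(1)]])
    have agree: "g (k y) = k' (l y)" if y: "y \<in> glue D s f ` f" for y
    proof -
      obtain x where x: "x \<in> f" "y = glue D s f x" using y by blast
      then show ?thesis using k(2)[OF x(1)] l(2)[OF x(1)] k'(2)[of "j x"] gh[of x] fb by auto
    qed
    have "(\<lambda>y. g (k y)) ` glue D s f ` f = g ` h ` f"
      unfolding image_image using k(2) by (intro image_cong) auto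
    then have f1: "(\<lambda>y. g (k y)) ` glue D s f ` f facet_of t'" using nb(2) by simp
    \<comment> \<open>The relation known on the glued face spreads to the whole neighbour, since
      both images of the neighbour lie across the same facet from \<open>t'\<close>.\<close>
    have "g (k y) = k' (l y)" if y: "y \<in> body D (nbr D s f)" for y
      by (rule isometries_agree_across_facet[OF gk k'l M.body_polyhedron[OF q] M.pairing(2)[OF s f] agree
            convex_polyhedronD(2,3,1)[OF nb(1)] convex_polyhedronD(2,3,1)[OF M'.lift_polyhedron[OF k'(1)]]
            convex_polyhedronD(2,3)[OF M'.lift_polyhedron[OF h']] f1 nb(5,6) y])
    then show "P u" unfolding P_def using l(1) k(1) k'(1) by blast
  qed
  have t0T: "t0 \<in> tiling G \<Gamma> D" using h0 \<Theta>(1)[OF j0] M.tiling_iff by blast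
  have PT: "P t" if "t \<in> tiling G \<Gamma> D" for t
    by (rule M.tile_induct[where P = P, OF t0T \<open>P t0\<close> step that])
  have gT: "g ` t \<in> tiling G \<Gamma>' D'" if t: "t \<in> tiling G \<Gamma> D" for t
  proof -
    obtain j p p' h t' h' where j: "(j, p, p') \<in> I" and h: "lifts G \<Gamma> D p t h"
      and h': "lifts G \<Gamma>' D' p' t' h'" and gh: "\<And>x. x \<in> body D p \<Longrightarrow> g (h x) = h' (j x)"
      using PT[OF t] unfolding P_def by blast
    have "g ` h ` body D p = h' ` j ` body D p"
      unfolding image_image using gh by (intro image_cong) auto
    then have "g ` t = t'"
      using M.lift_image[OF h] M'.lift_image[OF h'] \<Theta>(3)[OF j] by (simp add: isometry_def)
    then show ?thesis using h' \<Theta>(2)[OF j] M'.tiling_iff by blast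
  qed
  have "tiling G \<Gamma>' D' \<subseteq> (\<lambda>t. g ` t) ` tiling G \<Gamma> D"
  proof
    fix t' assume t': "t' \<in> tiling G \<Gamma>' D'"
    note t'p = convex_polyhedronD[OF M'.tile_polyhedron[OF t']]
    \<comment> \<open>The preimage of \<open>y\<close> may lie on the boundary of the tile
      \<open>t\<close> found below. Still \<open>y\<close> is in the closure of the interior of the
      image of \<open>t\<close>, so the open set \<open>interior t'\<close> meets that interior, and
      \<open>tile_unique\<close> applies.\<close>
    obtain y where y: "y \<in> interior t'" using t'p(3) by blast
    then have "y \<in> g ` model_space G"
      using t'p(1) interior_subset motion_image_model_space[OF g(1)] by blast
    then obtain x where x: "x \<in> model_space G" "y = g x" by blast
    obtain t where t: "t \<in> tiling G \<Gamma> D" "x \<in> t" using M.tiling_covers[OF x(1)] .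
    note gt = convex_polyhedronD[OF M'.tile_polyhedron[OF gT[OF t(1)]]]
    have "g ` t \<subseteq> closure (interior (g ` t))"
      unfolding convex_closure_interior[OF gt(2,3)] by (rule closure_subset)
    then have "y \<in> closure (interior (g ` t))" using t(2) x(2) by blast
    then have "interior (g ` t) \<inter> interior t' \<noteq> {}"
      using y open_Int_closure_eq_empty[OF open_interior[of t'], of "interior (g ` t)"] by blast
    then have "t' = g ` t" using M'.tile_unique[OF gT[OF t(1)] t'] by simp
    then show "t' \<in> (\<lambda>t. g ` t) ` tiling G \<Gamma> D" using t(1) by blast
  qed
  then show ?thesis
    unfolding isometric_tilings_def using giso gT by blast
qed

end

theorem theorem4p1:
  fixes G :: geometry
    and \<Gamma> \<Gamma>' :: "('a::euclidean_space \<Rightarrow> 'a) set"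
    and D :: "('a, 's) decomposition"
    and D' :: "('a, 't) decomposition"
  assumes "covering_group G \<Gamma>" and "covering_group G \<Gamma>'"
    and "decomposes G \<Gamma> D" and "decomposes G \<Gamma>' D'"
  shows "isometric_tilings G (tiling G \<Gamma> D) (tiling G \<Gamma>' D') \<longleftrightarrow>
    (\<exists>I. I \<noteq> {} \<and> I \<subseteq> Theta G D D' \<and>
       (\<forall>(j, p, p')\<in>I. \<forall>f. f facet_of body D p \<longrightarrow>
          (\<exists>\<tau>\<in>I. extends_across D D' (j, p, p') f \<tau>)))"
proof -
  interpret tiled_pair G \<Gamma> \<Gamma>' D D'
    by (intro tiled_pair.intro tiled_manifold.intro assms)
  show ?thesis
  proof
    assume "isometric_tilings G (tiling G \<Gamma> D) (tiling G \<Gamma>' D')"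
    from extendable_of_isometric[OF this] obtain I where I: "I \<noteq> {}" "I \<subseteq> Theta G D D'"
      "\<And>j p p' f. \<lbrakk>(j, p, p') \<in> I; f facet_of body D p\<rbrakk> \<Longrightarrow> \<exists>\<tau>\<in>I. extends_across D D' (j, p, p') f \<tau>"
      by metis
    then show "\<exists>I. I \<noteq> {} \<and> I \<subseteq> Theta G D D' \<and>
       (\<forall>(j, p, p')\<in>I. \<forall>f. f facet_of body D p \<longrightarrow>
          (\<exists>\<tau>\<in>I. extends_across D D' (j, p, p') f \<tau>))"
      by (intro exI[of _ I]) auto
  next
    assume "\<exists>I. I \<noteq> {} \<and> I \<subseteq> Theta G D D' \<and>
       (\<forall>(j, p, p')\<in>I. \<forall>f. f facet_of body D p \<longrightarrow>
          (\<exists>\<tau>\<in>I. extends_across D D' (j, p, p') f \<tau>))"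
    then obtain I where I: "I \<noteq> {}" "I \<subseteq> Theta G D D'"
      and ext: "\<forall>(j, p, p')\<in>I. \<forall>f. f facet_of body D p \<longrightarrow>
          (\<exists>\<tau>\<in>I. extends_across D D' (j, p, p') f \<tau>)"
      by blast
    show "isometric_tilings G (tiling G \<Gamma> D) (tiling G \<Gamma>' D')"
      by (rule isometric_of_extendable[OF I]) (use ext in blast)
  qed
qed

end
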